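(* There is an algorithm that, given a weighted game graph $(G,w)$ with $P(G,w)\ge 1$, an integer $M$ such that for every node $v$, $e^*_{G,w}(v)<\infty$ implies $e^*_{G,w}(v)\le M$, and an integer $c$ with $n\le c\le n\,P(G,w)$, computes an energy function $e$ such that \[ e(v)\le e^*_{G,w}(v)\le e(v)+c \] for every node $v$, in time $O(mnM/c)$.
   Context: A weighted game graph $(G,w)$ consists of a finite directed graph $G=(V,E)$ in which every node has out-degree at least $1$, a partition $V=V_A\cup V_B$ into nodes of Alice and of Bob, and integer edge weights $w:E\to\mathbb{Z}$; $n=|V|$, $m=|E|$. A (positional) strategy $\sigma$ of Alice picks for each $u\in V_A$ an out-neighbor $\sigma(u)$; a strategy $\tau$ of Bob picks for each $u\in V_B$ an out-neighbor $\tau(u)$. $G(\sigma,\tau)$ is the subgraph with edges $\{(u,\sigma(u)):u\in V_A\}\cup\{(u,\tau(u)):u\in V_B\}$; from any node $s$ there is a unique cycle $C$ reachable in it. $w(P)$ denotes the total weight of a path/cycle $P$. Set $e^*_{G(\sigma,\tau),w}(s)=\infty$ if $w(C)<0$, else $\max\{0,-\min_P w(P)\}$ over simple paths $P$ in $G(\sigma,\tau)$ starting at $s$. The minimal energy is $e^*_{G,w}(s)=\min_\sigma\max_\tau e^*_{G(\sigma,\tau),w}(s)$. An energy function is any map $V\to\mathbb{Z}_{\ge 0}\cup\{\infty\}$. A strategy $\tau^*$ of Bob is optimal (for $s$) if $e^*_{G(\sigma,\tau^* ),w}(s)\ge e^*_{G,w}(s)$ for all $\sigma$. Node $s$ has penalty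 at least $D\ge0$ if there is an optimal $\tau^*$ of Bob such that for every $\sigma$, the cycle $C$ reachable from $s$ in $G(\sigma,\tau^* )$ satisfies $w(C)<0\Rightarrow w(C)/|C|\le -D$; $P_{G,w}(s)$ is the supremum of such $D$, and $P(G,w)=\min_s P_{G,w}(s)$.
   Formalization: The running time is stated as O(m·max(1, nM/c)) instead of O(mnM/c): when nM < c (for example M = 0) the literal bound is below linear, even zero, which no algorithm can meet; for nM ≥ c the bounds agree. *)

theory Defs
  imports
    Complex_Main
    "HOL-Library.Extended_Nat"
    "HOL-Library.Extended_Real"
    "HOL-Library.FuncSet"
    "Graph_Theory.Pair_Digraph"
begin

section \<open>Weighted game graphs and minimal energies\<close>

record 'v game =
  graph  :: "'v pair_pre_digraph"
  alice  :: "'v set"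
  bob    :: "'v set"
  weight :: "'v \<times> 'v \<Rightarrow> int"

text \<open>
  The node set is nonempty, since the penalty of a game is a minimum over all nodes.
  Self-loops are allowed.
\<close>

definition weighted_game :: "'v game \<Rightarrow> bool" where
  "weighted_game \<Gamma> \<longleftrightarrow>
     pair_fin_digraph (graph \<Gamma>) \<and> pverts (graph \<Gamma>) \<noteq> {} \<and>
     (\<forall>u \<in> pverts (graph \<Gamma>). \<exists>v. (u, v) \<in> parcs (graph \<Gamma>)) \<and>
     alice \<Gamma> \<union> bob \<Gamma> = pverts (graph \<Gamma>) \<and> alice \<Gamma> \<inter> bob \<Gamma> = {}"

text \<open>Strategies are extensional functions, so that each player has finitely many of them.\<close>

definition strategies :: "'v game \<Rightarrow> 'v set \<Rightarrow> ('v \<Rightarrow> 'v) set" where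
  "strategies \<Gamma> U = (\<Pi>\<^sub>E u \<in> U. {v. (u, v) \<in> parcs (graph \<Gamma>)})"

abbreviation alice_strategies :: "'v game \<Rightarrow> ('v \<Rightarrow> 'v) set" where
  "alice_strategies \<Gamma> \<equiv> strategies \<Gamma> (alice \<Gamma>)"

abbreviation bob_strategies :: "'v game \<Rightarrow> ('v \<Rightarrow> 'v) set" where
  "bob_strategies \<Gamma> \<equiv> strategies \<Gamma> (bob \<Gamma>)"

definition play_graph :: "'v game \<Rightarrow> ('v \<Rightarrow> 'v) \<Rightarrow> ('v \<Rightarrow> 'v) \<Rightarrow> 'v pair_pre_digraph" where
  "play_graph \<Gamma> \<sigma> \<tau> =
     \<lparr>pverts = pverts (graph \<Gamma>),
      parcs = {(u, \<sigma> u) | u. u \<in> alice \<Gamma>} \<union> {(u, \<tau> u) | u. u \<in> bob \<Gamma>}\<rparr>"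

definition path_weight :: "'v game \<Rightarrow> ('v \<times> 'v) list \<Rightarrow> int" where
  "path_weight \<Gamma> p = sum_list (map (weight \<Gamma>) p)"

text \<open>
  A cycle is a list of arcs.  From every node of a play graph exactly one cycle can be
  reached; as a list it is determined up to rotation, which changes neither its weight nor
  its length.
\<close>

definition reachable_cycle :: "'v pair_pre_digraph \<Rightarrow> 'v \<Rightarrow> ('v \<times> 'v) list \<Rightarrow> bool" where
  "reachable_cycle H s C \<longleftrightarrow>
     pre_digraph.cycle (with_proj H) C \<and> reachable (with_proj H) s (fst (hd C))"

definition play_energy :: "'v game \<Rightarrow> ('v \<Rightarrow> 'v) \<Rightarrow> ('v \<Rightarrow> 'v) \<Rightarrow> 'v \<Rightarrow> enat" where
  "play_energy \<Gamma> \<sigma> \<tau> s =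
     (let H = play_graph \<Gamma> \<sigma> \<tau> in
      if \<exists>C. reachable_cycle H s C \<and> path_weight \<Gamma> C < 0 then \<infinity>
      else enat (nat (max 0
             (- Min {path_weight \<Gamma> p | p v. pre_digraph.apath (with_proj H) s p v}))))"

definition min_energy :: "'v game \<Rightarrow> 'v \<Rightarrow> enat" where
  "min_energy \<Gamma> s =
     (MIN \<sigma> \<in> alice_strategies \<Gamma>. MAX \<tau> \<in> bob_strategies \<Gamma>. play_energy \<Gamma> \<sigma> \<tau> s)"

definition optimal_for_bob :: "'v game \<Rightarrow> 'v \<Rightarrow> ('v \<Rightarrow> 'v) \<Rightarrow> bool" where
  "optimal_for_bob \<Gamma> s \<tau> \<longleftrightarrow>
     \<tau> \<in> bob_strategies \<Gamma> \<and>
     (\<forall>\<sigma> \<in> alice_strategies \<Gamma>. play_energy \<Gamma> \<sigma> \<tau> s \<ge> min_energy \<Gamma> s)"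

definition has_penalty :: "'v game \<Rightarrow> 'v \<Rightarrow> real \<Rightarrow> bool" where
  "has_penalty \<Gamma> s D \<longleftrightarrow>
     (\<exists>\<tau>. optimal_for_bob \<Gamma> s \<tau> \<and>
       (\<forall>\<sigma> \<in> alice_strategies \<Gamma>. \<forall>C. reachable_cycle (play_graph \<Gamma> \<sigma> \<tau>) s C \<longrightarrow>
          path_weight \<Gamma> C < 0 \<longrightarrow>
          real_of_int (path_weight \<Gamma> C) / real (length C) \<le> - D))"

text \<open>The penalty is infinite if arbitrarily large values of \<open>D\<close> are admissible.\<close>

definition node_penalty :: "'v game \<Rightarrow> 'v \<Rightarrow> ereal" where
  "node_penalty \<Gamma> s = Sup {ereal D | D. D \<ge> 0 \<and> has_penalty \<Gamma> s D}"

definition penalty :: "'v game \<Rightarrow> ereal" where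
  "penalty \<Gamma> = (MIN s \<in> pverts (graph \<Gamma>). node_penalty \<Gamma> s)"

section \<open>A word RAM\<close>

text \<open>
  Algorithms are programs of a fixed imperative language over integer variables and integer
  arrays.  All operations have unit cost, and all values occurring in a run have to fit into
  a machine word, i.e. have absolute value at most \<open>U\<close>; a run that violates this is stuck.
  Without the word bound, unit-cost arithmetic would be unreasonably powerful.
  \<open>Quot\<close> rounds towards minus infinity, and yields 0 for divisor 0.
\<close>

type_synonym name = string

datatype aexp =
    Const int
  | Var name
  | Read name aexp
  | Add aexp aexp
  | Sub aexp aexp
  | Mul aexp aexp
  | Quot aexp aexp

datatype bexp =
    Less aexp aexp
  | Neg bexp
  | Conj bexp bexp

datatype com =
    Skip
  | Assign name aexp
  | Write name aexp aexp
  | Seq com com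
  | Cond bexp com com
  | Loop bexp com

record state =
  vars   :: "name \<Rightarrow> int"
  arrays :: "name \<Rightarrow> int \<Rightarrow> int"

fun aval :: "state \<Rightarrow> aexp \<Rightarrow> int" where
  "aval s (Const k) = k"
| "aval s (Var x) = vars s x"
| "aval s (Read a e) = arrays s a (aval s e)"
| "aval s (Add e f) = aval s e + aval s f"
| "aval s (Sub e f) = aval s e - aval s f"
| "aval s (Mul e f) = aval s e * aval s f"
| "aval s (Quot e f) = aval s e div aval s f"

fun bval :: "state \<Rightarrow> bexp \<Rightarrow> bool" where
  "bval s (Less e f) \<longleftrightarrow> aval s e < aval s f"
| "bval s (Neg b) \<longleftrightarrow> \<not> bval s b"
| "bval s (Conj b d) \<longleftrightarrow> bval s b \<and> bval s d"

fun asubs :: "aexp \<Rightarrow> aexp set" where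
  "asubs (Const k) = {Const k}"
| "asubs (Var x) = {Var x}"
| "asubs (Read a e) = insert (Read a e) (asubs e)"
| "asubs (Add e f) = insert (Add e f) (asubs e \<union> asubs f)"
| "asubs (Sub e f) = insert (Sub e f) (asubs e \<union> asubs f)"
| "asubs (Mul e f) = insert (Mul e f) (asubs e \<union> asubs f)"
| "asubs (Quot e f) = insert (Quot e f) (asubs e \<union> asubs f)"

definition afits :: "int \<Rightarrow> state \<Rightarrow> aexp \<Rightarrow> bool" where
  "afits U s e \<longleftrightarrow> (\<forall>f \<in> asubs e. \<bar>aval s f\<bar> \<le> U)"

fun bfits :: "int \<Rightarrow> state \<Rightarrow> bexp \<Rightarrow> bool" where
  "bfits U s (Less e f) \<longleftrightarrow> afits U s e \<and> afits U s f"
| "bfits U s (Neg b) \<longleftrightarrow> bfits U s b"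
| "bfits U s (Conj b d) \<longleftrightarrow> bfits U s b \<and> bfits U s d"

fun acost :: "aexp \<Rightarrow> nat" where
  "acost (Const k) = 1"
| "acost (Var x) = 1"
| "acost (Read a e) = 1 + acost e"
| "acost (Add e f) = 1 + acost e + acost f"
| "acost (Sub e f) = 1 + acost e + acost f"
| "acost (Mul e f) = 1 + acost e + acost f"
| "acost (Quot e f) = 1 + acost e + acost f"

fun bcost :: "bexp \<Rightarrow> nat" where
  "bcost (Less e f) = 1 + acost e + acost f"
| "bcost (Neg b) = 1 + bcost b"
| "bcost (Conj b d) = 1 + bcost b + bcost d"

text \<open>
  \<open>exec U p s t s'\<close>: with word bound \<open>U\<close>, program \<open>p\<close> started in state \<open>s\<close> halts in state
  \<open>s'\<close> after \<open>t\<close> steps.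
\<close>

inductive exec :: "int \<Rightarrow> com \<Rightarrow> state \<Rightarrow> nat \<Rightarrow> state \<Rightarrow> bool" for U :: int where
  Skip: "exec U Skip s 1 s"
| Assign: "afits U s e \<Longrightarrow>
    exec U (Assign x e) s (1 + acost e) (s\<lparr>vars := (vars s)(x := aval s e)\<rparr>)"
| Write: "afits U s i \<Longrightarrow> afits U s e \<Longrightarrow>
    exec U (Write a i e) s (1 + acost i + acost e)
      (s\<lparr>arrays := (arrays s)(a := (arrays s a)(aval s i := aval s e))\<rparr>)"
| Seq: "exec U p s t s' \<Longrightarrow> exec U q s' t' s'' \<Longrightarrow> exec U (Seq p q) s (1 + t + t') s''"
| CondTrue: "bfits U s b \<Longrightarrow> bval s b \<Longrightarrow> exec U p s t s' \<Longrightarrow>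
    exec U (Cond b p q) s (1 + bcost b + t) s'"
| CondFalse: "bfits U s b \<Longrightarrow> \<not> bval s b \<Longrightarrow> exec U q s t s' \<Longrightarrow>
    exec U (Cond b p q) s (1 + bcost b + t) s'"
| LoopFalse: "bfits U s b \<Longrightarrow> \<not> bval s b \<Longrightarrow> exec U (Loop b p) s (1 + bcost b) s"
| LoopTrue: "bfits U s b \<Longrightarrow> bval s b \<Longrightarrow> exec U p s t s' \<Longrightarrow> exec U (Loop b p) s' t' s'' \<Longrightarrow>
    exec U (Loop b p) s (1 + bcost b + t + t') s''"

inductive_cases exec_SkipE: "exec U Skip s t s'"
  and exec_AssignE: "exec U (Assign x e) s t s'"
  and exec_WriteE: "exec U (Write a i e) s t s'"
  and exec_SeqE: "exec U (Seq p q) s t s'"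
  and exec_CondE: "exec U (Cond b p q) s t s'"
  and exec_LoopE: "exec U (Loop b p) s t s'"

lemma exec_deterministic:
  "exec U p s t s' \<Longrightarrow> exec U p s u s'' \<Longrightarrow> u = t \<and> s'' = s'"
proof (induction arbitrary: u s'' rule: exec.induct)
  case Skip
  then show ?case by (elim exec_SkipE) simp
next
  case Assign
  from Assign.prems show ?case by (elim exec_AssignE) simp
next
  case Write
  from Write.prems show ?case by (elim exec_WriteE) simp
next
  case Seq
  from Seq.prems show ?case by (elim exec_SeqE) (use Seq.IH in force)
next
  case CondTrue
  from CondTrue.prems CondTrue.hyps show ?case by (elim exec_CondE) (use CondTrue.IH in force)+
next
  case CondFalse
  from CondFalse.prems CondFalse.hyps show ?case by (elim exec_CondE) (use CondFalse.IH in force)+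
next
  case (LoopFalse s b p)
  show ?case
    by (rule exec_LoopE[OF LoopFalse.prems]) (simp, use LoopFalse.hyps(2) in blast)
next
  case (LoopTrue s b p t s' t' s2)
  show ?case
  proof (rule exec_LoopE[OF LoopTrue.prems])
    assume "\<not> bval s b"
    with LoopTrue.hyps(2) show ?thesis by blast
  next
    fix t1 s1 t2
    assume "u = Suc (bcost b + t1 + t2)" and "exec U p s t1 s1" and "exec U (Loop b p) s1 t2 s''"
    with LoopTrue.IH show ?thesis by force
  qed
qed

section \<open>Input and output\<close>

definition array_of :: "int list \<Rightarrow> int \<Rightarrow> int" where
  "array_of xs i = (if 0 \<le> i \<and> i < int (length xs) then xs ! nat i else 0)"

text \<open>
  The nodes of an input game are \<open>0, \<dots>, n - 1\<close>.  The arcs are given by an arbitrary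
  enumeration \<open>es\<close>; for the \<open>i\<close>-th arc, its end points and its weight are stored.
  All other variables and array cells are initially 0.
\<close>

definition input_state :: "nat game \<Rightarrow> (nat \<times> nat) list \<Rightarrow> int \<Rightarrow> int \<Rightarrow> state" where
  "input_state \<Gamma> es M c =
     \<lparr>vars = (\<lambda>_. 0)
        (''n'' := int (card (pverts (graph \<Gamma>))),
         ''m'' := int (length es),
         ''M'' := M,
         ''c'' := c),
      arrays = (\<lambda>_ _. 0)
        (''alice'' := array_of (map (\<lambda>v. if v \<in> alice \<Gamma> then 1 else 0)
                                    [0..<card (pverts (graph \<Gamma>))]),
         ''source'' := array_of (map (\<lambda>a. int (fst a)) es),
         ''target'' := array_of (map (\<lambda>a. int (snd a)) es),
         ''weight'' := array_of (map (weight \<Gamma>) es))\<rparr>"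

text \<open>
  The words of the machine have \<open>O(log N)\<close> bits, where \<open>N\<close> is the following magnitude of the
  input.  That is, the word bound is a fixed power of \<open>N\<close>.
\<close>

definition input_magnitude :: "'v game \<Rightarrow> int \<Rightarrow> int \<Rightarrow> int" where
  "input_magnitude \<Gamma> M c =
     int (card (pverts (graph \<Gamma>))) + int (card (parcs (graph \<Gamma>))) +
     Max ((\<lambda>a. \<bar>weight \<Gamma> a\<bar>) ` parcs (graph \<Gamma>)) + \<bar>M\<bar> + \<bar>c\<bar>"

text \<open>The output is an array of integers, with negative numbers representing \<open>\<infinity>\<close>.\<close>

definition output_energy :: "state \<Rightarrow> nat \<Rightarrow> enat" where
  "output_energy s v =
     (let x = arrays s ''energy'' (int v) in if x < 0 then \<infinity> else enat (nat x))"

end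

theory Submission
  imports Defs
begin

text \<open>
  Put \<open>B = c div n\<close> and round every weight up to a multiple of \<open>B\<close>.  Energies can only decrease.
  A cycle that is negative under an optimal strategy of Bob has average weight at most \<open>- D\<close> for
  some \<open>D > B - 1\<close>, so it remains negative, and the weight of a simple path changes by less
  than \<open>n B \<le> c\<close>; hence an energy increases by at most \<open>c\<close> when the rounding is undone.
  In units of \<open>B\<close>, finite energies are below \<open>T = M div B + 1\<close>, so lifting the nodes one
  unit at a time, with work proportional to their degree per unit, takes time
  \<open>O(m T) = O(m n M / c)\<close>.

  The least fixed point of the lifting equals the minimal energy because, once the strategy of Alice is
  fixed, Bob can follow any simple path, and any path into a negative cycle, by a positional
  strategy: his best response is the supremum over all walks.
\<close>

section \<open>Energies in terms of walks\<close>

text \<open>The choice of \<open>B\<close> answers two demands: \<open>n * B \<le> c\<close> keeps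
  the error small, and \<open>B\<close> must not exceed the penalty, so that negative cycles stay
  negative. The hypothesis on \<open>c\<close> says that \<open>c / n\<close> meets both. An integer
  grows by at most \<open>B - 1\<close> when rounded up, so an admissible \<open>D > B - 1\<close>
  is enough, and it exists even if the supremum defining the penalty is not attained.

  The obstacle to the time bound is that rechecking a node of Alice whenever a neighbour changes
  would cost its out-degree each time. Hence arcs, not nodes, carry the progress: each arc records
  how many values it has ruled out, and a counter for each node and value records how many outgoing
  arcs agree. A node rises when a counter meets its threshold, and only the arcs into it are
  revisited. The counters need no initialisation, since memory starts at zero.

  Correctness comes from two sides: an invariant keeps the computed values at most the energies of
  the rounded game, and at a halt they satisfy local inequalities from which Alice reads off a
  strategy.\<close>

lemma path_weight_simps [simp]:
  "path_weight \<Gamma> [] = 0"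
  "path_weight \<Gamma> (a # p) = weight \<Gamma> a + path_weight \<Gamma> p"
  "path_weight \<Gamma> (p @ q) = path_weight \<Gamma> p + path_weight \<Gamma> q"
  by (simp_all add: path_weight_def)

abbreviation awalk_in :: "'v pair_pre_digraph \<Rightarrow> 'v \<Rightarrow> ('v \<times> 'v) list \<Rightarrow> 'v \<Rightarrow> bool" where
  "awalk_in H \<equiv> pre_digraph.awalk (with_proj H)"

abbreviation apath_in :: "'v pair_pre_digraph \<Rightarrow> 'v \<Rightarrow> ('v \<times> 'v) list \<Rightarrow> 'v \<Rightarrow> bool" where
  "apath_in H \<equiv> pre_digraph.apath (with_proj H)"

section \<open>Removing and repeating closed subwalks\<close>

context pair_wf_digraph
begin

text \<open>A repeated node splits the walk into two shorter closed walks whose weights have a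
  negative sum, so one of them is negative. The first arc is set aside because the start node recurs
  at the end of every closed walk; only a repetition after that arc gives a decomposition.\<close>

lemma negative_closed_walk_imp_cycle:
  assumes "awalk u p u" "path_weight \<Gamma> p < 0"
  shows "\<exists>C. cycle C \<and> path_weight \<Gamma> C < 0 \<and> set C \<subseteq> set p"
  using assms
proof (induction "length p" arbitrary: u p rule: less_induct)
  case less
  have "p \<noteq> []" using less.prems by auto
  show ?case
  proof (cases "distinct (tl (pawalk_verts u p))")
    case True
    then have "cycle p" using less.prems \<open>p \<noteq> []\<close> unfolding cycle_def by auto
    then show ?thesis using less.prems by blast
  next
    case False
    obtain e es where p: "p = e # es" using \<open>p \<noteq> []\<close> by (cases p) auto
    have w: "awalk (snd e) es u" and nd: "\<not> distinct (pawalk_verts (snd e) es)"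
      and e: "e \<in> parcs G" "fst e = u"
      using False less.prems p by (auto simp: awalk_Cons_iff)
    obtain q r s x where d: "es = q @ r @ s" "0 < length r"
      "awalk (snd e) q x" "awalk x r x" "awalk x s u"
      using awalk_not_distinct_decomp[OF w nd] by blast
    show ?thesis
    proof (cases "path_weight \<Gamma> r < 0")
      case True
      have "\<exists>C. cycle C \<and> path_weight \<Gamma> C < 0 \<and> set C \<subseteq> set r"
        by (rule less.hyps[OF _ d(4) True]) (simp add: p d)
      then show ?thesis using p d by fastforce
    next
      case False
      have aw: "awalk u (e # q @ s) u"
        using awalk_appendI[OF d(3) d(5)] e by (auto simp: awalk_Cons_iff simp del: awalk_append_iff)
      have "\<exists>C. cycle C \<and> path_weight \<Gamma> C < 0 \<and> set C \<subseteq> set (e # q @ s)"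
        by (rule less.hyps[OF _ aw]) (use False less.prems d in \<open>auto simp: p\<close>)
      then show ?thesis using p d by fastforce
    qed
  qed
qed

text \<open>Cutting out a closed subwalk of nonnegative weight never makes the walk heavier; a
  negative one gives the second alternative.\<close>

lemma walk_imp_light_path:
  assumes "awalk u p v"
  shows "(\<exists>q. apath u q v \<and> path_weight \<Gamma> q \<le> path_weight \<Gamma> p) \<or>
         (\<exists>q r w. awalk u q w \<and> awalk w r w \<and> path_weight \<Gamma> r < 0)"
  using assms
proof (induction "length p" arbitrary: p rule: less_induct)
  case less
  show ?case
  proof (cases "distinct (pawalk_verts u p)")
    case True
    then show ?thesis using less.prems unfolding apath_def by auto
  next
    case False
    obtain q r s x where d: "p = q @ r @ s" "0 < length r"
      "awalk u q x" "awalk x r x" "awalk x s v"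
      using awalk_not_distinct_decomp[OF less.prems False] by blast
    show ?thesis
    proof (cases "path_weight \<Gamma> r < 0")
      case True
      then show ?thesis using d by blast
    next
      case ge: False
      have "(\<exists>t. apath u t v \<and> path_weight \<Gamma> t \<le> path_weight \<Gamma> (q @ s)) \<or>
         (\<exists>q r w. awalk u q w \<and> awalk w r w \<and> path_weight \<Gamma> r < 0)"
        by (rule less.hyps) (use d awalk_appendI[OF d(3) d(5)] in auto)
      then show ?thesis
      proof
        assume "\<exists>t. apath u t v \<and> path_weight \<Gamma> t \<le> path_weight \<Gamma> (q @ s)"
        then obtain t where "apath u t v" "path_weight \<Gamma> t \<le> path_weight \<Gamma> (q @ s)" by blast
        moreover have "path_weight \<Gamma> (q @ s) \<le> path_weight \<Gamma> p" using ge d by simp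
        ultimately show ?thesis using order_trans by blast
      qed blast
    qed
  qed
qed

lemma negative_cycle_iff_closed_walk:
  "(\<exists>C. reachable_cycle G s C \<and> path_weight \<Gamma> C < 0) \<longleftrightarrow>
   (\<exists>q r w. awalk s q w \<and> awalk w r w \<and> path_weight \<Gamma> r < 0)" (is "?L \<longleftrightarrow> ?R")
proof
  assume ?L
  then obtain C u where C: "awalk u C u" "C \<noteq> []" "reachable (with_proj G) s (fst (hd C))"
    "path_weight \<Gamma> C < 0"
    unfolding reachable_cycle_def cycle_def by auto
  then have "fst (hd C) = u" by (cases C) (auto simp: awalk_Cons_iff)
  then show ?R using C unfolding reachable_awalk by auto
next
  assume ?R
  then obtain q r w where d: "awalk s q w" "awalk w r w" "path_weight \<Gamma> r < 0" by blast
  obtain C where C: "cycle C" "path_weight \<Gamma> C < 0" "set C \<subseteq> set r"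
    using negative_closed_walk_imp_cycle[OF d(2,3)] by blast
  have "C \<noteq> []" using C by auto
  then have "hd C \<in> set r" using C by auto
  then have "fst (hd C) \<in> set (pawalk_verts w r)"
    using awalk_verts_arc1 d(2) by auto
  then have "reachable (with_proj G) w (fst (hd C))"
    using awalk_verts_reachable_from d(2) by blast
  moreover have "reachable (with_proj G) s w" using d(1) reachable_awalk by blast
  ultimately show ?L using C reachable_trans unfolding reachable_cycle_def by blast
qed

lemma negative_closed_walk_unbounded:
  assumes "awalk s q w" "awalk w r w" "path_weight \<Gamma> r < 0"
  shows "\<exists>p. awalk s p w \<and> path_weight \<Gamma> p < x"
proof -
  have iter: "\<exists>p. awalk s p w \<and> path_weight \<Gamma> p = path_weight \<Gamma> q + int k * path_weight \<Gamma> r" for k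
  proof (induction k)
    case 0
    then show ?case using assms by auto
  next
    case (Suc k)
    then obtain p where "awalk s p w" "path_weight \<Gamma> p = path_weight \<Gamma> q + int k * path_weight \<Gamma> r"
      by blast
    then show ?case using awalk_appendI[OF _ assms(2)]
      by (intro exI[of _ "p @ r"]) (auto simp: algebra_simps simp del: awalk_append_iff)
  qed
  \<comment> \<open>Weights are integers, so each further round along \<open>r\<close> lowers the
    weight by at least 1.\<close>
  define k where "k = nat (path_weight \<Gamma> q - x) + 1"
  have "int k * path_weight \<Gamma> r \<le> int k * (-1)"
    by (rule mult_left_mono) (use assms(3) in auto)
  moreover have "int k > path_weight \<Gamma> q - x" unfolding k_def by linarith
  ultimately show ?thesis using iter[of k] by fastforce
qed

end

section \<open>Plays, and the graph left when Alice has fixed her strategy\<close>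

locale game =
  fixes \<Gamma> :: "'v game"
  assumes weighted_game: "weighted_game \<Gamma>"
begin

abbreviation V :: "'v set" where "V \<equiv> pverts (graph \<Gamma>)"
abbreviation E :: "('v \<times> 'v) set" where "E \<equiv> parcs (graph \<Gamma>)"

sublocale pair_fin_digraph "graph \<Gamma>"
  using weighted_game unfolding weighted_game_def by blast

lemma out_arc: "u \<in> V \<Longrightarrow> \<exists>v. (u, v) \<in> E"
  and players: "alice \<Gamma> \<union> bob \<Gamma> = V" "alice \<Gamma> \<inter> bob \<Gamma> = {}"
  and V_nonempty: "V \<noteq> {}"
  using weighted_game unfolding weighted_game_def by auto

lemma finite_strategies:
  assumes "U \<subseteq> V" shows "finite (strategies \<Gamma> U)"
  unfolding strategies_def
proof (rule finite_PiE)
  show "finite U" using assms pair_finite_verts finite_subset by blast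
  fix u
  have "{v. (u, v) \<in> E} \<subseteq> snd ` E" by force
  then show "finite {v. (u, v) \<in> E}"
    using pair_finite_arcs finite_subset by blast
qed

lemma strategies_nonempty:
  assumes "U \<subseteq> V" shows "strategies \<Gamma> U \<noteq> {}"
  unfolding strategies_def using assms out_arc by (subst PiE_eq_empty_iff) blast

lemma strategies_arc: "\<sigma> \<in> strategies \<Gamma> U \<Longrightarrow> u \<in> U \<Longrightarrow> (u, \<sigma> u) \<in> E"
  unfolding strategies_def by auto

lemma alice_finite: "finite (alice_strategies \<Gamma>)" and alice_ne: "alice_strategies \<Gamma> \<noteq> {}"
  and bob_finite: "finite (bob_strategies \<Gamma>)" and bob_ne: "bob_strategies \<Gamma> \<noteq> {}"
  using finite_strategies strategies_nonempty players by auto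

text \<open>The one-player game that Bob faces. Its walks may leave a node of Bob by different arcs
  at different visits, which no positional strategy allows; \<open>bob_energy_le_iff\<close> shows
  that this freedom gains him nothing.\<close>

definition alice_graph :: "('v \<Rightarrow> 'v) \<Rightarrow> 'v pair_pre_digraph" where
  "alice_graph \<sigma> = \<lparr>pverts = V, parcs = {(u, v) \<in> E. u \<in> alice \<Gamma> \<longrightarrow> v = \<sigma> u}\<rparr>"

lemma pverts_restricted [simp]:
  "pverts (play_graph \<Gamma> \<sigma> \<tau>) = V" "pverts (alice_graph \<sigma>) = V"
  by (simp_all add: play_graph_def alice_graph_def)

lemma play_graph_arcs:
  assumes "\<sigma> \<in> alice_strategies \<Gamma>" "\<tau> \<in> bob_strategies \<Gamma>"
  shows "parcs (play_graph \<Gamma> \<sigma> \<tau>) \<subseteq> parcs (alice_graph \<sigma>)"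
  using assms players strategies_arc unfolding play_graph_def alice_graph_def by auto

lemma alice_graph_arcs: "parcs (alice_graph \<sigma>) \<subseteq> E"
  unfolding alice_graph_def by auto

lemma pair_fin_digraph_subgraph:
  assumes "pverts H = V" "parcs H \<subseteq> E" shows "pair_fin_digraph H"
proof
  show "finite (pverts H)" "finite (parcs H)"
    using assms pair_finite_verts finite_subset[OF assms(2) pair_finite_arcs] by auto
qed (use assms in_arcsD1 in_arcsD2 in \<open>auto 4 3\<close>)

lemma fin_alice_graph: "pair_fin_digraph (alice_graph \<sigma>)"
  by (rule pair_fin_digraph_subgraph) (use alice_graph_arcs in auto)

lemma fin_play_graph:
  assumes "\<sigma> \<in> alice_strategies \<Gamma>" "\<tau> \<in> bob_strategies \<Gamma>"
  shows "pair_fin_digraph (play_graph \<Gamma> \<sigma> \<tau>)"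
  by (rule pair_fin_digraph_subgraph) (use play_graph_arcs[OF assms] alice_graph_arcs in auto)

lemma awalk_mono:
  "awalk_in H u p v \<Longrightarrow> pverts H = pverts H' \<Longrightarrow> parcs H \<subseteq> parcs H' \<Longrightarrow> awalk_in H' u p v"
  unfolding pre_digraph.awalk_def by (simp add: cas_with_proj_eq) blast

lemma play_energy_le_iff_paths:
  assumes st: "\<sigma> \<in> alice_strategies \<Gamma>" "\<tau> \<in> bob_strategies \<Gamma>" and s: "s \<in> V"
  defines "H \<equiv> play_graph \<Gamma> \<sigma> \<tau>"
  shows "play_energy \<Gamma> \<sigma> \<tau> s \<le> enat x \<longleftrightarrow>
    \<not> (\<exists>C. reachable_cycle H s C \<and> path_weight \<Gamma> C < 0) \<and>
    (\<forall>p v. apath_in H s p v \<longrightarrow> - path_weight \<Gamma> p \<le> int x)"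
proof -
  interpret H: pair_fin_digraph H unfolding H_def by (rule fin_play_graph[OF st])
  define S where "S = {path_weight \<Gamma> p | p v. apath_in H s p v}"
  have "S \<subseteq> (\<lambda>(u, p, v). path_weight \<Gamma> p) ` {(u, p, v). H.apath u p v}"
    unfolding S_def by force
  then have fin: "finite S" using H.apaths_finite_triple finite_surj by blast
  have "H.apath s [] s" using s unfolding H_def by (simp add: H.apath_Nil_iff[unfolded H_def])
  \<comment> \<open>The empty path has weight 0, so \<open>Min\<close> ranges over a nonempty
    set.\<close>
  then have "0 \<in> S" unfolding S_def by force
  then have "S \<noteq> {}" by auto
  have "(nat (max 0 (- Min S)) \<le> x) \<longleftrightarrow> - int x \<le> Min S" by auto
  also have "\<dots> \<longleftrightarrow> (\<forall>y \<in> S. - int x \<le> y)" using fin \<open>S \<noteq> {}\<close> by simp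
  also have "\<dots> \<longleftrightarrow> (\<forall>p v. apath_in H s p v \<longrightarrow> - path_weight \<Gamma> p \<le> int x)"
    unfolding S_def minus_le_iff[of _ "int x"] by blast
  finally show ?thesis
    unfolding play_energy_def Let_def H_def[symmetric] S_def[symmetric] by auto
qed

text \<open>One bound on all walks absorbs both cases of the definition: repeating a negative cycle
  would violate it, and without negative cycles every walk has a simple path of at most its
  weight.\<close>

lemma play_energy_le_iff_walks:
  assumes st: "\<sigma> \<in> alice_strategies \<Gamma>" "\<tau> \<in> bob_strategies \<Gamma>" and s: "s \<in> V"
  defines "H \<equiv> play_graph \<Gamma> \<sigma> \<tau>"
  shows "play_energy \<Gamma> \<sigma> \<tau> s \<le> enat x \<longleftrightarrow>
    (\<forall>p v. awalk_in H s p v \<longrightarrow> - path_weight \<Gamma> p \<le> int x)"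
proof -
  interpret H: pair_fin_digraph H unfolding H_def by (rule fin_play_graph[OF st])
  note paths = play_energy_le_iff_paths[OF st s, of x, folded H_def]
  show ?thesis
  proof
    assume "play_energy \<Gamma> \<sigma> \<tau> s \<le> enat x"
    then have no: "\<not> (\<exists>q r w. H.awalk s q w \<and> H.awalk w r w \<and> path_weight \<Gamma> r < 0)"
      and le: "\<And>p v. H.apath s p v \<Longrightarrow> - path_weight \<Gamma> p \<le> int x"
      using paths H.negative_cycle_iff_closed_walk by blast+
    show "\<forall>p v. H.awalk s p v \<longrightarrow> - path_weight \<Gamma> p \<le> int x"
    proof (intro allI impI)
      fix p v assume "H.awalk s p v"
      then obtain q where "H.apath s q v" "path_weight \<Gamma> q \<le> path_weight \<Gamma> p"
        using H.walk_imp_light_path no by blast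
      then show "- path_weight \<Gamma> p \<le> int x" using le[of q v] by simp
    qed
  next
    assume all: "\<forall>p v. H.awalk s p v \<longrightarrow> - path_weight \<Gamma> p \<le> int x"
    have "\<not> (\<exists>q r w. H.awalk s q w \<and> H.awalk w r w \<and> path_weight \<Gamma> r < 0)"
    proof
      assume "\<exists>q r w. H.awalk s q w \<and> H.awalk w r w \<and> path_weight \<Gamma> r < 0"
      then obtain p w where "H.awalk s p w" "path_weight \<Gamma> p < - int x"
        using H.negative_closed_walk_unbounded by blast
      then show False using all by force
    qed
    then show "play_energy \<Gamma> \<sigma> \<tau> s \<le> enat x"
      using paths all H.negative_cycle_iff_closed_walk unfolding H.apath_def by blast
  qed
qed

text \<open>Bob obeys \<open>F\<close> wherever \<open>F\<close> has an arc and chooses arbitrarily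
  elsewhere. At nodes of Alice, \<open>F\<close> agrees with \<sigma> already.\<close>

lemma bob_strategy_following:
  assumes \<sigma>: "\<sigma> \<in> alice_strategies \<Gamma>"
    and F: "F \<subseteq> parcs (alice_graph \<sigma>)" "single_valued F"
  shows "\<exists>\<tau> \<in> bob_strategies \<Gamma>. F \<subseteq> parcs (play_graph \<Gamma> \<sigma> \<tau>)"
proof -
  define \<tau> where "\<tau> = restrict (\<lambda>u. SOME v. (u, v) \<in> E \<and> (\<forall>v'. (u, v') \<in> F \<longrightarrow> v = v')) (bob \<Gamma>)"
  have *: "(u, \<tau> u) \<in> E \<and> (\<forall>v'. (u, v') \<in> F \<longrightarrow> \<tau> u = v')" if "u \<in> bob \<Gamma>" for u
  proof -
    have "\<exists>v. (u, v) \<in> E \<and> (\<forall>v'. (u, v') \<in> F \<longrightarrow> v = v')"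
    proof (cases "\<exists>v. (u, v) \<in> F")
      case True
      then show ?thesis using F alice_graph_arcs unfolding single_valued_def by blast
    next
      case False
      then show ?thesis using out_arc players that by blast
    qed
    from someI_ex[OF this] show ?thesis using that unfolding \<tau>_def by simp
  qed
  have "\<tau> \<in> bob_strategies \<Gamma>"
    unfolding strategies_def using * by (auto simp: \<tau>_def)
  moreover have "F \<subseteq> parcs (play_graph \<Gamma> \<sigma> \<tau>)"
  proof
    fix a assume a: "a \<in> F"
    obtain u v where uv: "a = (u, v)" by (cases a)
    then have "(u, v) \<in> E" "u \<in> alice \<Gamma> \<Longrightarrow> v = \<sigma> u" using a F unfolding alice_graph_def by auto
    moreover have "u \<in> V" using \<open>(u, v) \<in> E\<close> in_arcsD1 by blast
    ultimately show "a \<in> parcs (play_graph \<Gamma> \<sigma> \<tau>)"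
      using *[of u] players a uv unfolding play_graph_def by auto
  qed
  ultimately show ?thesis by blast
qed

end

section \<open>Functional subgraphs that lead into a cycle\<close>

lemma (in pair_wf_digraph) single_valued_walk:
  assumes "awalk u p v" "distinct (map fst p)"
  shows "single_valued (set p)"
proof (rule single_valuedI)
  fix x y z assume "(x, y) \<in> set p" "(x, z) \<in> set p"
  then show "y = z"
    using assms(2) inj_onD[of fst "set p" "(x, y)" "(x, z)"] by (simp add: distinct_map)
qed

text \<open>A walk into a cycle may revisit nodes or cross the cycle, so its arcs need not fit a
  positional strategy. Reading it backwards and adding an arc only where none starts yet keeps the
  set functional, while everything still leads to \<open>c\<close>.\<close>

lemma (in pair_wf_digraph) reach_in_functional_subgraph:
  assumes "awalk s q c" "single_valued F" "F \<subseteq> parcs G" "c \<in> Domain F"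
    "\<forall>x \<in> Domain F. (x, c) \<in> F\<^sup>*"
  shows "\<exists>F'. F \<subseteq> F' \<and> single_valued F' \<and> F' \<subseteq> parcs G \<and> s \<in> Domain F' \<and>
    (\<forall>x \<in> Domain F'. (x, c) \<in> F'\<^sup>*)"
  using assms(1)
proof (induction q arbitrary: s)
  case Nil
  then show ?case using assms by (auto simp: awalk_Nil_iff)
next
  case (Cons a q)
  then obtain u where a: "a = (s, u)" "(s, u) \<in> parcs G" "awalk u q c"
    by (cases a) (auto simp: awalk_Cons_iff)
  obtain F' where F': "F \<subseteq> F'" "single_valued F'" "F' \<subseteq> parcs G" "u \<in> Domain F'"
    "\<forall>x \<in> Domain F'. (x, c) \<in> F'\<^sup>*"
    using Cons.IH[OF a(3)] by blast
  show ?case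
  proof (cases "s \<in> Domain F'")
    case True
    then show ?thesis using F' by blast
  next
    case False
    let ?F = "insert (s, u) F'"
    have "single_valued ?F" using F'(2) False unfolding single_valued_def by blast
    moreover have sub: "F'\<^sup>* \<subseteq> ?F\<^sup>*" by (rule rtrancl_mono) auto
    moreover have "(s, c) \<in> ?F\<^sup>*"
      using F'(4,5) sub by (meson converse_rtrancl_into_rtrancl insertI1 subsetD)
    ultimately show ?thesis using F' a by (intro exI[of _ ?F]) auto
  qed
qed

lemma (in pair_wf_digraph) rtrancl_imp_awalk:
  assumes "(x, y) \<in> F\<^sup>*" "F \<subseteq> parcs G" "y \<in> pverts G"
  shows "\<exists>p. awalk x p y"
  using assms(1)
proof (induction rule: converse_rtrancl_induct)
  case base
  then show ?case using assms(3) awalk_Nil_iff by blast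
next
  case (step x z)
  then obtain p where "awalk z p y" by blast
  then have "awalk x ((x, z) # p) y" using step assms(2) in_arcsD1 by (auto simp: awalk_Cons_iff)
  then show ?case by blast
qed

lemma (in pair_wf_digraph) closed_walk_rtrancl:
  assumes "awalk u p v" "x \<in> fst ` set p"
  shows "(x, v) \<in> (set p)\<^sup>*"
  using assms
proof (induction p arbitrary: u x)
  case Nil
  then show ?case by simp
next
  case (Cons a p)
  have w: "awalk (snd a) p v" and fa: "fst a = u" using Cons.prems by (auto simp: awalk_Cons_iff)
  have sub: "(set p)\<^sup>* \<subseteq> (set (a # p))\<^sup>*" by (rule rtrancl_mono) auto
  have tail: "(snd a, v) \<in> (set (a # p))\<^sup>*"
  proof (cases p)
    case Nil
    then show ?thesis using w by (auto simp: awalk_Nil_iff)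
  next
    case (Cons b p')
    then have "snd a \<in> fst ` set p" using w by (auto simp: awalk_Cons_iff)
    then show ?thesis using Cons.IH[OF w] sub by blast
  qed
  show ?case
  proof (cases "x = fst a")
    case True
    have "(fst a, snd a) \<in> set (a # p)" by simp
    then show ?thesis using tail True by (meson converse_rtrancl_into_rtrancl)
  next
    case False
    then have "x \<in> fst ` set p" using Cons.prems by auto
    then show ?thesis using Cons.IH[OF w] sub by blast
  qed
qed

section \<open>Best responses of Bob, and the minimal energy as a bound on walks\<close>

context game
begin

text \<open>Negative closed walks have to be excluded first: only then does every walk reduce to a
  simple path. A simple path is a functional arc set, and a negative cycle with a way into it
  extends to one, so \<open>bob_strategy_following\<close> realises each in an actual play.\<close>

lemma bob_energy_le_iff:
  assumes \<sigma>: "\<sigma> \<in> alice_strategies \<Gamma>" and s: "s \<in> V"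
  shows "(MAX \<tau> \<in> bob_strategies \<Gamma>. play_energy \<Gamma> \<sigma> \<tau> s) \<le> enat x \<longleftrightarrow>
    (\<forall>p v. awalk_in (alice_graph \<sigma>) s p v \<longrightarrow> - path_weight \<Gamma> p \<le> int x)" (is "?L \<longleftrightarrow> ?R")
proof -
  have L: "?L \<longleftrightarrow> (\<forall>\<tau> \<in> bob_strategies \<Gamma>. play_energy \<Gamma> \<sigma> \<tau> s \<le> enat x)"
    using bob_finite bob_ne by simp
  interpret A: pair_fin_digraph "alice_graph \<sigma>" by (rule fin_alice_graph)
  show ?thesis
  proof
    assume ?R
    then show ?L unfolding L
      using play_energy_le_iff_walks[OF \<sigma> _ s] awalk_mono play_graph_arcs[OF \<sigma>]
      by (metis pverts_restricted)
  next
    assume ?L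
    then have le: "\<And>\<tau>. \<tau> \<in> bob_strategies \<Gamma> \<Longrightarrow> play_energy \<Gamma> \<sigma> \<tau> s \<le> enat x"
      using L by blast
    have no_closed: "\<not> (A.awalk s q w \<and> A.awalk w r w \<and> path_weight \<Gamma> r < 0)" for q r w
    proof
      assume "A.awalk s q w \<and> A.awalk w r w \<and> path_weight \<Gamma> r < 0"
      then obtain C where "reachable_cycle (alice_graph \<sigma>) s C" and neg: "path_weight \<Gamma> C < 0"
        using A.negative_cycle_iff_closed_walk by blast
      then obtain c q where C: "A.awalk c C c" "distinct (tl (pawalk_verts c C))" "C \<noteq> []"
        "A.awalk s q (fst (hd C))"
        unfolding reachable_cycle_def A.cycle_def A.reachable_awalk by blast
      have c: "fst (hd C) = c" using C by (cases C) (auto simp: A.awalk_Cons_iff)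
      \<comment> \<open>\<open>cycle\<close> makes the heads of the arcs distinct, while a
        positional strategy needs distinct tails; on a closed walk both lists contain the same
        nodes.\<close>
      have "tl (pawalk_verts c C) = map snd C"
        using A.awalk_verts_conv'[of c C c] C by auto
      then have "distinct (map snd C)" using C by simp
      moreover have "fst ` set C = snd ` set C"
      proof -
        have "pawalk_verts c C = map fst C @ [c]"
          using A.awalk_verts_conv[of c C] C by (auto dest: A.awlast_of_awalk)
        moreover have "pawalk_verts c C = c # map snd C"
          using A.awalk_verts_conv'[of c C c] C c by auto
        ultimately have eq: "map fst C @ [c] = c # map snd C" by simp
        then have "mset (map fst C @ [c]) = mset (c # map snd C)" by simp
        then have "mset (map fst C) = mset (map snd C)" by simp
        then show ?thesis by (metis image_set set_mset_mset)
      qed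
      ultimately have "distinct (map fst C)"
        by (metis card_distinct distinct_card length_map list.set_map)
      then have sv: "single_valued (set C)" using A.single_valued_walk C by blast
      have dom: "\<forall>x \<in> Domain (set C). (x, c) \<in> (set C)\<^sup>*"
        using A.closed_walk_rtrancl[OF C(1)] by force
      have q: "A.awalk s q c" using C(4) c by simp
      have sub: "set C \<subseteq> parcs (alice_graph \<sigma>)" using C(1) by auto
      have "c \<in> Domain (set C)" using c C(3) by (metis Domain_fst hd_in_set imageI)
      then obtain F where F: "set C \<subseteq> F" "single_valued F" "F \<subseteq> parcs (alice_graph \<sigma>)"
        "s \<in> Domain F" "\<forall>x \<in> Domain F. (x, c) \<in> F\<^sup>*"
        using A.reach_in_functional_subgraph[OF q sv sub _ dom] by metis
      obtain \<tau> where \<tau>: "\<tau> \<in> bob_strategies \<Gamma>" "F \<subseteq> parcs (play_graph \<Gamma> \<sigma> \<tau>)"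
        using bob_strategy_following[OF \<sigma> F(3,2)] by blast
      interpret H: pair_fin_digraph "play_graph \<Gamma> \<sigma> \<tau>" by (rule fin_play_graph[OF \<sigma> \<tau>(1)])
      have aC: "H.awalk c C c"
        using C(1) F(1) \<tau>(2) unfolding A.awalk_def H.awalk_def by auto
      moreover obtain q where "H.awalk s q c"
        using H.rtrancl_imp_awalk[OF _ \<tau>(2)] F(4,5) aC by blast
      ultimately obtain p where "H.awalk s p c" "path_weight \<Gamma> p < - int x"
        using H.negative_closed_walk_unbounded neg by blast
      then show False
        using le[OF \<tau>(1)] play_energy_le_iff_walks[OF \<sigma> \<tau>(1) s] by force
    qed
    show ?R
    proof (intro allI impI)
      fix p v assume "A.awalk s p v"
      then obtain q where q: "A.apath s q v" "path_weight \<Gamma> q \<le> path_weight \<Gamma> p"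
        using A.walk_imp_light_path no_closed by blast
      then have aw: "A.awalk s q v" and "distinct (pawalk_verts s q)" unfolding A.apath_def by auto
      then have "distinct (map fst q)" using A.awalk_verts_conv[of s q] by (auto split: if_splits)
      then have "single_valued (set q)" using A.single_valued_walk aw by blast
      then obtain \<tau> where \<tau>: "\<tau> \<in> bob_strategies \<Gamma>" "set q \<subseteq> parcs (play_graph \<Gamma> \<sigma> \<tau>)"
        using bob_strategy_following[OF \<sigma>] aw by blast
      then have "awalk_in (play_graph \<Gamma> \<sigma> \<tau>) s q v"
        using aw unfolding pre_digraph.awalk_def by (simp add: cas_with_proj_eq)
      then have "- path_weight \<Gamma> q \<le> int x"
        using le[OF \<tau>(1)] play_energy_le_iff_walks[OF \<sigma> \<tau>(1) s] by blast
      then show "- path_weight \<Gamma> p \<le> int x" using q by simp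
    qed
  qed
qed

text \<open>What remains of the min-max is a choice of \<sigma> and a bound on walks. Walks can be
  extended at the front by an arc, which gives the local inequalities below.\<close>

lemma min_energy_le_iff:
  assumes s: "s \<in> V"
  shows "min_energy \<Gamma> s \<le> enat x \<longleftrightarrow>
    (\<exists>\<sigma> \<in> alice_strategies \<Gamma>. \<forall>p v. awalk_in (alice_graph \<sigma>) s p v \<longrightarrow> - path_weight \<Gamma> p \<le> int x)"
proof -
  have "min_energy \<Gamma> s \<le> enat x \<longleftrightarrow>
    (\<exists>\<sigma> \<in> alice_strategies \<Gamma>. (MAX \<tau> \<in> bob_strategies \<Gamma>. play_energy \<Gamma> \<sigma> \<tau> s) \<le> enat x)"
    unfolding min_energy_def using alice_finite alice_ne by (subst Min_le_iff) auto
  then show ?thesis using bob_energy_le_iff[OF _ s] by blast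
qed

text \<open>A \<sigma> that certifies \<open>k\<close> at \<open>v\<close> also certifies the
  remaining energy at each successor \<open>u\<close>, since prefixing the arc turns walks from
  \<open>u\<close> into walks from \<open>v\<close>; the empty walk at \<open>u\<close> shows that
  the arc itself is affordable.\<close>

lemma min_energy_step:
  assumes "min_energy \<Gamma> v \<le> enat k" "v \<in> V"
  shows "\<exists>\<sigma> \<in> alice_strategies \<Gamma>. \<forall>u. (v, u) \<in> parcs (alice_graph \<sigma>) \<longrightarrow>
    0 \<le> int k + weight \<Gamma> (v, u) \<and> min_energy \<Gamma> u \<le> enat (nat (int k + weight \<Gamma> (v, u)))"
proof -
  obtain \<sigma> where \<sigma>: "\<sigma> \<in> alice_strategies \<Gamma>"
    and le: "\<And>p u. awalk_in (alice_graph \<sigma>) v p u \<Longrightarrow> - path_weight \<Gamma> p \<le> int k"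
    using iffD1[OF min_energy_le_iff[OF assms(2)] assms(1)] by blast
  interpret A: pair_fin_digraph "alice_graph \<sigma>" by (rule fin_alice_graph)
  show ?thesis
  proof (intro bexI[of _ \<sigma>] allI impI)
    fix u assume a: "(v, u) \<in> parcs (alice_graph \<sigma>)"
    then have u: "u \<in> V" using A.in_arcsD2 by simp
    have "- path_weight \<Gamma> p \<le> int k + weight \<Gamma> (v, u)" if "A.awalk u p t" for p t
    proof -
      have "A.awalk v ((v, u) # p) t" using that a A.in_arcsD1 by (auto simp: A.awalk_Cons_iff)
      from le[OF this] show ?thesis by simp
    qed
    moreover from this[of "[]" u] have "0 \<le> int k + weight \<Gamma> (v, u)"
      using u by (simp add: A.awalk_Nil_iff)
    ultimately show "0 \<le> int k + weight \<Gamma> (v, u) \<and>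
        min_energy \<Gamma> u \<le> enat (nat (int k + weight \<Gamma> (v, u)))"
      using \<sigma> unfolding min_energy_le_iff[OF u] by (intro conjI bexI[of _ \<sigma>] allI impI) auto
  qed (rule \<sigma>)
qed

lemma min_energy_step_alice:
  assumes "min_energy \<Gamma> v \<le> enat k" "v \<in> alice \<Gamma>"
  shows "\<exists>u. (v, u) \<in> E \<and> 0 \<le> int k + weight \<Gamma> (v, u) \<and>
    min_energy \<Gamma> u \<le> enat (nat (int k + weight \<Gamma> (v, u)))"
proof -
  have "v \<in> V" using assms players by blast
  from min_energy_step[OF assms(1) this] show ?thesis
    using strategies_arc assms(2) unfolding alice_graph_def by fastforce
qed

lemma min_energy_step_bob:
  assumes "min_energy \<Gamma> v \<le> enat k" "v \<in> bob \<Gamma>" "(v, u) \<in> E"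
  shows "0 \<le> int k + weight \<Gamma> (v, u) \<and>
    min_energy \<Gamma> u \<le> enat (nat (int k + weight \<Gamma> (v, u)))"
proof -
  have "v \<in> V" "v \<notin> alice \<Gamma>" using assms players by blast+
  with min_energy_step[OF assms(1)] show ?thesis
    using assms(3) unfolding alice_graph_def by auto
qed

text \<open>The nodes with \<open>e v < T\<close> are those whose value is finite.\<close>

lemma min_energy_le_progress_measure:
  fixes e :: "'v \<Rightarrow> int"
  assumes nonneg: "\<And>v. v \<in> V \<Longrightarrow> 0 \<le> e v"
    and alice: "\<And>v. v \<in> alice \<Gamma> \<Longrightarrow> e v < T \<Longrightarrow>
      \<exists>u. (v, u) \<in> E \<and> e u < T \<and> e u \<le> e v + weight \<Gamma> (v, u)"
    and bob: "\<And>v u. v \<in> bob \<Gamma> \<Longrightarrow> e v < T \<Longrightarrow> (v, u) \<in> E \<Longrightarrow>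
      e u < T \<and> e u \<le> e v + weight \<Gamma> (v, u)"
    and s: "s \<in> V" "e s < T"
  shows "min_energy \<Gamma> s \<le> enat (nat (e s))"
proof -
  \<comment> \<open>At nodes of value at least \<open>T\<close> every arc is good, so that \<sigma>
    is a total strategy.\<close>
  define good where "good v u \<longleftrightarrow> (v, u) \<in> E \<and>
    (e v < T \<longrightarrow> e u < T \<and> e u \<le> e v + weight \<Gamma> (v, u))" for v u
  define \<sigma> where "\<sigma> = restrict (\<lambda>v. SOME u. good v u) (alice \<Gamma>)"
  have good: "good v (\<sigma> v)" if "v \<in> alice \<Gamma>" for v
  proof -
    have "\<exists>u. good v u" using alice[OF that] out_arc that players unfolding good_def by blast
    then show ?thesis using that unfolding \<sigma>_def by (simp add: someI_ex)
  qed
  have \<sigma>: "\<sigma> \<in> alice_strategies \<Gamma>"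
    unfolding strategies_def using good by (auto simp: \<sigma>_def good_def)
  interpret A: pair_fin_digraph "alice_graph \<sigma>" by (rule fin_alice_graph)
  have step: "e u < T \<and> e u \<le> e v + weight \<Gamma> (v, u)"
    if "(v, u) \<in> parcs (alice_graph \<sigma>)" "e v < T" for v u
  proof -
    have "(v, u) \<in> E" "v \<in> alice \<Gamma> \<Longrightarrow> u = \<sigma> v" using that unfolding alice_graph_def by auto
    then show ?thesis
      using good[of v] bob[of v u] that in_arcsD1 players unfolding good_def by blast
  qed
  \<comment> \<open>The inequalities of the single arcs telescope; with \<open>0 \<le> e t\<close>
    this bounds the loss along the walk by \<open>e s\<close>.\<close>
  have walk: "e t \<le> e v + path_weight \<Gamma> p \<and> e t < T" if "A.awalk v p t" "e v < T" for v p t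
    using that
  proof (induction p arbitrary: v)
    case Nil
    then show ?case by (simp add: A.awalk_Nil_iff)
  next
    case (Cons a p)
    obtain u where a: "a = (v, u)" "(v, u) \<in> parcs (alice_graph \<sigma>)" "A.awalk u p t"
      using Cons.prems by (cases a) (auto simp: A.awalk_Cons_iff)
    show ?case using Cons.IH[OF a(3)] step[OF a(2)] Cons.prems a(1) by force
  qed
  have "- path_weight \<Gamma> p \<le> int (nat (e s))" if "A.awalk s p t" for p t
  proof -
    have "t \<in> V" using that A.awalk_last_in_verts by simp
    then show ?thesis using walk[OF that s(2)] nonneg[of t] nonneg[OF s(1)] by auto
  qed
  then show ?thesis using min_energy_le_iff[OF s(1)] \<sigma> by blast
qed

end

section \<open>Rounding the weights\<close>

text \<open>The ceiling of the weight divided by \<open>B\<close>. Weights are kept in units of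
  \<open>B\<close>, so an energy \<open>x\<close> of the rounded game stands for
  \<open>B * x\<close>.\<close>

definition round_up :: "int \<Rightarrow> 'v game \<Rightarrow> 'v game" where
  "round_up B \<Gamma> = \<Gamma>\<lparr>weight := \<lambda>a. - ((- weight \<Gamma> a) div B)\<rparr>"

lemma round_up_simps [simp]:
  "graph (round_up B \<Gamma>) = graph \<Gamma>" "alice (round_up B \<Gamma>) = alice \<Gamma>" "bob (round_up B \<Gamma>) = bob \<Gamma>"
  "weight (round_up B \<Gamma>) a = - ((- weight \<Gamma> a) div B)"
  "strategies (round_up B \<Gamma>) = strategies \<Gamma>" "play_graph (round_up B \<Gamma>) = play_graph \<Gamma>"
  by (simp_all add: round_up_def strategies_def play_graph_def fun_eq_iff)

text \<open>An integer grows by at most \<open>B - 1\<close> when rounded up to a multiple of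
  \<open>B\<close>; this exact amount per arc is what the penalty has to beat.\<close>

lemma round_up_path_weight:
  assumes "B > 0"
  shows "path_weight \<Gamma> p \<le> B * path_weight (round_up B \<Gamma>) p"
    and "B * path_weight (round_up B \<Gamma>) p \<le> path_weight \<Gamma> p + (B - 1) * int (length p)"
proof (induction p)
  case (Cons a p)
  have "B * ((- weight \<Gamma> a) div B) + (- weight \<Gamma> a) mod B = - weight \<Gamma> a"
    by (rule mult_div_mod_eq)
  moreover have "0 \<le> (- weight \<Gamma> a) mod B" "(- weight \<Gamma> a) mod B < B" using assms by simp_all
  ultimately have "weight \<Gamma> a \<le> B * weight (round_up B \<Gamma>) a"
    "B * weight (round_up B \<Gamma>) a \<le> weight \<Gamma> a + (B - 1)"
    unfolding round_up_simps mult_minus_right by linarith+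
  then show "path_weight \<Gamma> (a # p) \<le> B * path_weight (round_up B \<Gamma>) (a # p)"
    "B * path_weight (round_up B \<Gamma>) (a # p) \<le> path_weight \<Gamma> (a # p) + (B - 1) * int (length (a # p))"
    using Cons.IH by (simp_all add: algebra_simps del: round_up_simps)
qed simp_all

context game
begin

lemma game_round_up: "game (round_up B \<Gamma>)"
  using weighted_game by unfold_locales (simp add: weighted_game_def)

lemma alice_graph_round_up [simp]: "game.alice_graph (round_up B \<Gamma>) = alice_graph"
  by (simp add: fun_eq_iff alice_graph_def game.alice_graph_def[OF game_round_up])

text \<open>Alice keeps her strategy: no walk becomes lighter, and a loss counted in whole units of
  \<open>B\<close> is at most the floor of \<open>y / B\<close>.\<close>

lemma min_energy_round_up_le:
  assumes B: "B > 0" and s: "s \<in> V" and le: "min_energy \<Gamma> s \<le> enat y"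
  shows "min_energy (round_up B \<Gamma>) s \<le> enat (nat (int y div B))"
proof -
  obtain \<sigma> where \<sigma>: "\<sigma> \<in> alice_strategies \<Gamma>"
    and w: "\<And>p u. awalk_in (alice_graph \<sigma>) s p u \<Longrightarrow> - path_weight \<Gamma> p \<le> int y"
    using iffD1[OF min_energy_le_iff[OF s] le] by blast
  have "- path_weight (round_up B \<Gamma>) p \<le> int (nat (int y div B))"
    if "awalk_in (alice_graph \<sigma>) s p u" for p u
  proof -
    have "(- path_weight (round_up B \<Gamma>) p) * B \<le> int y"
      using w[OF that] round_up_path_weight(1)[OF B, of \<Gamma> p] by (simp add: algebra_simps)
    then have "- path_weight (round_up B \<Gamma>) p \<le> int y div B"
      using B zdiv_mono1[of "- path_weight (round_up B \<Gamma>) p * B" "int y" B]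
      by (simp del: mult_minus_left)
    then show ?thesis using B by (simp add: pos_imp_zdiv_nonneg_iff)
  qed
  moreover have s': "s \<in> pverts (graph (round_up B \<Gamma>))" using s by simp
  ultimately show ?thesis
    using \<sigma> unfolding game.min_energy_le_iff[OF game_round_up s'] alice_graph_round_up round_up_simps
    by blast
qed

text \<open>Consider the play of a \<sigma> that achieves \<open>x\<close> in the rounded game
  against Bob's optimal \<tau> of the original game. Optimality of \<tau> bounds the minimal energy
  by this single play, and the penalty covers its cycle: were it negative, its average weight would
  be below \<open>- (B - 1)\<close>, so it would remain negative after rounding.\<close>

lemma min_energy_le_round_up:
  assumes B: "B > 0" and s: "s \<in> V"
    and D: "has_penalty \<Gamma> s D" "real_of_int B - 1 < D"
    and le: "min_energy (round_up B \<Gamma>) s \<le> enat x"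
  shows "min_energy \<Gamma> s \<le> enat (nat (B * int x + B * int (card V)))"
proof -
  interpret R: game "round_up B \<Gamma>" by (rule game_round_up)
  obtain \<tau> where \<tau>: "optimal_for_bob \<Gamma> s \<tau>"
    and pen: "\<And>\<sigma> C. \<sigma> \<in> alice_strategies \<Gamma> \<Longrightarrow> reachable_cycle (play_graph \<Gamma> \<sigma> \<tau>) s C \<Longrightarrow>
      path_weight \<Gamma> C < 0 \<Longrightarrow> real_of_int (path_weight \<Gamma> C) / real (length C) \<le> - D"
    using D(1) unfolding has_penalty_def by blast
  have \<tau>_bob: "\<tau> \<in> bob_strategies \<Gamma>"
    and opt: "\<And>\<sigma>. \<sigma> \<in> alice_strategies \<Gamma> \<Longrightarrow> min_energy \<Gamma> s \<le> play_energy \<Gamma> \<sigma> \<tau> s"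
    using \<tau> unfolding optimal_for_bob_def by blast+
  obtain \<sigma> where \<sigma>: "\<sigma> \<in> alice_strategies \<Gamma>"
    and "(MAX \<tau> \<in> bob_strategies \<Gamma>. play_energy (round_up B \<Gamma>) \<sigma> \<tau> s) \<le> enat x"
    using le alice_finite alice_ne unfolding min_energy_def by (subst (asm) Min_le_iff) auto
  then have "play_energy (round_up B \<Gamma>) \<sigma> \<tau> s \<le> enat x"
    using bob_finite \<tau>_bob by (subst (asm) Max_le_iff) auto
  then have no: "\<not> (\<exists>C. reachable_cycle (play_graph \<Gamma> \<sigma> \<tau>) s C \<and> path_weight (round_up B \<Gamma>) C < 0)"
    and paths: "\<And>p v. apath_in (play_graph \<Gamma> \<sigma> \<tau>) s p v \<Longrightarrow>
      - path_weight (round_up B \<Gamma>) p \<le> int x"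
    using R.play_energy_le_iff_paths[of \<sigma> \<tau> s x] \<sigma> \<tau>_bob s by auto
  interpret H: pair_fin_digraph "play_graph \<Gamma> \<sigma> \<tau>" by (rule fin_play_graph[OF \<sigma> \<tau>_bob])
  have "\<not> (reachable_cycle (play_graph \<Gamma> \<sigma> \<tau>) s C \<and> path_weight \<Gamma> C < 0)" for C
  proof
    assume C: "reachable_cycle (play_graph \<Gamma> \<sigma> \<tau>) s C \<and> path_weight \<Gamma> C < 0"
    then have "length C > 0" unfolding reachable_cycle_def H.cycle_def by auto
    moreover have "real_of_int (path_weight \<Gamma> C) / real (length C) < - (real_of_int B - 1)"
      using pen[OF \<sigma>] C D(2) by force
    ultimately have "real_of_int (path_weight \<Gamma> C) < - (real_of_int B - 1) * real (length C)"
      by (simp add: pos_divide_less_eq)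
    then have "real_of_int (path_weight \<Gamma> C) < real_of_int (- (B - 1) * int (length C))" by simp
    then have "path_weight \<Gamma> C + (B - 1) * int (length C) < 0" by linarith
    then have "B * path_weight (round_up B \<Gamma>) C < 0"
      using round_up_path_weight(2)[OF B, of \<Gamma> C] by linarith
    then have "path_weight (round_up B \<Gamma>) C < 0" using B by (simp add: mult_less_0_iff)
    then show False using no C by blast
  qed
  moreover have "- path_weight \<Gamma> p \<le> int (nat (B * int x + B * int (card V)))"
    if "apath_in (play_graph \<Gamma> \<sigma> \<tau>) s p v" for p v
  proof -
    have "B * (- path_weight (round_up B \<Gamma>) p) \<le> B * int x"
      using paths[OF that] B by (intro mult_left_mono) auto
    moreover have "(B - 1) * int (length p) \<le> B * int (card V)"
      using H.length_apath[OF that] B by (intro mult_mono) auto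
    ultimately show ?thesis using round_up_path_weight(2)[OF B, of \<Gamma> p] by simp
  qed
  ultimately have "play_energy \<Gamma> \<sigma> \<tau> s \<le> enat (nat (B * int x + B * int (card V)))"
    using play_energy_le_iff_paths[OF \<sigma> \<tau>_bob s] by blast
  then show ?thesis using opt[OF \<sigma>] by (rule order_trans[rotated])
qed

text \<open>The supremum need not be attained, hence the strict bound on the penalty.\<close>

lemma penalty_witness:
  assumes s: "s \<in> V" and "ereal x < penalty \<Gamma>"
  shows "\<exists>D. has_penalty \<Gamma> s D \<and> x < D"
proof -
  have "penalty \<Gamma> \<le> node_penalty \<Gamma> s"
    unfolding penalty_def using pair_finite_verts s by (intro Min_le) auto
  then have "ereal x < node_penalty \<Gamma> s" using assms by simp
  then show ?thesis unfolding node_penalty_def less_Sup_iff by auto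
qed

end

section \<open>Verifying programs\<close>

text \<open>Loops are rejected here and left to \<open>loop_sound\<close>. For loop-free programs,
  \<open>cost\<close> bounds the running time independently of the state.\<close>

fun wp :: "int \<Rightarrow> com \<Rightarrow> (state \<Rightarrow> bool) \<Rightarrow> state \<Rightarrow> bool" where
  "wp U Skip Q s \<longleftrightarrow> Q s"
| "wp U (Assign x e) Q s \<longleftrightarrow> afits U s e \<and> Q (s\<lparr>vars := (vars s)(x := aval s e)\<rparr>)"
| "wp U (Write a i e) Q s \<longleftrightarrow> afits U s i \<and> afits U s e \<and>
     Q (s\<lparr>arrays := (arrays s)(a := (arrays s a)(aval s i := aval s e))\<rparr>)"
| "wp U (Seq p q) Q s \<longleftrightarrow> wp U p (wp U q Q) s"
| "wp U (Cond b p q) Q s \<longleftrightarrow> bfits U s b \<and> (if bval s b then wp U p Q s else wp U q Q s)"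
| "wp U (Loop b p) Q s \<longleftrightarrow> False"

fun cost :: "com \<Rightarrow> nat" where
  "cost Skip = 1"
| "cost (Assign x e) = 1 + acost e"
| "cost (Write a i e) = 1 + acost i + acost e"
| "cost (Seq p q) = 1 + cost p + cost q"
| "cost (Cond b p q) = 1 + bcost b + max (cost p) (cost q)"
| "cost (Loop b p) = 0"

lemma wp_sound:
  "wp U p Q s \<Longrightarrow> \<exists>t s'. exec U p s t s' \<and> t \<le> cost p \<and> Q s'"
proof (induction p arbitrary: Q s)
  case (Seq p q)
  then obtain t s' where "exec U p s t s'" "t \<le> cost p" "wp U q Q s'" by fastforce
  moreover from this obtain t' s'' where "exec U q s' t' s''" "t' \<le> cost q" "Q s''"
    using Seq.IH by blast
  ultimately show ?case by (fastforce intro: exec.Seq)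
next
  case (Cond b p q)
  show ?case
  proof (cases "bval s b")
    case True
    then obtain t s' where "exec U p s t s'" "t \<le> cost p" "Q s'" using Cond by fastforce
    then show ?thesis using True Cond.prems by (fastforce intro: exec.CondTrue)
  next
    case False
    then obtain t s' where "exec U q s t s'" "t \<le> cost q" "Q s'" using Cond by fastforce
    then show ?thesis using False Cond.prems by (fastforce intro: exec.CondFalse)
  qed
qed (force intro: exec.intros)+

text \<open>Each round lowers \<mu>, so there are at most \<open>\<mu> s\<close> rounds; the added 1
  pays for the final failing test of the guard.\<close>

lemma loop_sound:
  fixes \<mu> :: "state \<Rightarrow> nat"
  assumes body: "\<And>s. I s \<Longrightarrow> bval s b \<Longrightarrow> wp U p (\<lambda>s'. I s' \<and> \<mu> s' < \<mu> s) s"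
    and fits: "\<And>s. I s \<Longrightarrow> bfits U s b"
    and "I s"
  shows "\<exists>t s'. exec U (Loop b p) s t s' \<and> t \<le> (\<mu> s + 1) * (1 + bcost b + cost p) \<and>
    I s' \<and> \<not> bval s' b"
  using \<open>I s\<close>
proof (induction "\<mu> s" arbitrary: s rule: less_induct)
  case less
  show ?case
  proof (cases "bval s b")
    case True
    obtain t s' where 1: "exec U p s t s'" "t \<le> cost p" "I s'" "\<mu> s' < \<mu> s"
      using wp_sound[OF body[OF less.prems True]] by blast
    obtain t' s'' where 2: "exec U (Loop b p) s' t' s''"
      "t' \<le> (\<mu> s' + 1) * (1 + bcost b + cost p)" "I s''" "\<not> bval s'' b"
      using less.hyps[OF 1(4,3)] by blast
    have "t' \<le> \<mu> s * (1 + bcost b + cost p)"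
      by (rule order_trans[OF 2(2) mult_le_mono1]) (use 1(4) in simp)
    then have "1 + bcost b + t + t' \<le> (\<mu> s + 1) * (1 + bcost b + cost p)"
      using 1(2) by (simp add: algebra_simps)
    then show ?thesis
      using exec.LoopTrue[OF fits[OF less.prems] True 1(1) 2(1)] 2 by blast
  next
    case False
    then show ?thesis using exec.LoopFalse[OF fits[OF less.prems] False] less.prems
      by (intro exI conjI) auto
  qed
qed

section \<open>The lifting algorithm\<close>

lemma sum_eq_except:
  fixes f g :: "'a \<Rightarrow> int"
  assumes "finite A" "a \<in> A" "\<And>x. x \<in> A \<Longrightarrow> x \<noteq> a \<Longrightarrow> g x = f x"
  shows "sum g A = sum f A + (g a - f a)"
proof -
  have "sum g (A - {a}) = sum f (A - {a})" using assms by (intro sum.cong) auto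
  then show ?thesis using assms(1,2) by (simp add: sum.remove)
qed

text \<open>Row-major addresses in the counter table do not collide, so writing one counter leaves
  the others alone.\<close>

lemma index_inject:
  fixes v v' k k' T :: int
  assumes "v * T + k = v' * T + k'" "0 \<le> k" "k < T" "0 \<le> k'" "k' < T"
  shows "v = v' \<and> k = k'"
proof -
  have T: "T \<noteq> 0" "k div T = 0" "k' div T = 0"
    using assms(2-5) by (auto simp: div_pos_pos_trivial)
  have "(v * T + k) div T = v" "(v' * T + k') div T = v'"
    unfolding div_mult_self3[OF T(1)] T(2,3) by simp_all
  then show ?thesis using assms(1) by simp
qed

text \<open>
  Arcs are numbered \<open>0, \<dots>, m - 1\<close>, and \<open>d i\<close> is the negated weight of arc \<open>i\<close>.
  The value \<open>T\<close> represents \<open>\<infinity>\<close>.  The level \<open>lev i\<close> of an arc is the number of values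
  \<open>k < T\<close> that arc \<open>i\<close> is known to rule out as the energy of its source, and \<open>Z v k\<close> says
  that the energy of node \<open>v\<close> exceeds \<open>k\<close>.
\<close>

locale lifting =
  fixes n m T :: int and src tgt d :: "int \<Rightarrow> int" and al :: "int \<Rightarrow> bool"
    and Z :: "int \<Rightarrow> int \<Rightarrow> bool"
  assumes n_nonneg: "0 \<le> n" and m_nonneg: "0 \<le> m" and T_nonneg: "0 \<le> T"
    and src: "\<And>i. 0 \<le> i \<Longrightarrow> i < m \<Longrightarrow> 0 \<le> src i \<and> src i < n"
    and tgt: "\<And>i. 0 \<le> i \<Longrightarrow> i < m \<Longrightarrow> 0 \<le> tgt i \<and> tgt i < n"
    and out: "\<And>v. 0 \<le> v \<Longrightarrow> v < n \<Longrightarrow> \<exists>i. 0 \<le> i \<and> i < m \<and> src i = v"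
begin

text \<open>The weight of the arc is \<open>- d i\<close>. Energy \<open>k\<close> fails at the
  source if no finite energy suffices at the target, if the arc alone consumes more than
  \<open>k\<close>, or if too little is left after it. An energy above \<open>T - 1\<close> counts
  as infinite.\<close>

definition forced :: "int \<Rightarrow> int \<Rightarrow> bool" where
  "forced i k \<longleftrightarrow> Z (tgt i) (T - 1) \<or> k < d i \<or> Z (tgt i) (k - d i)"

definition outs :: "int \<Rightarrow> int set" where
  "outs v = {i \<in> {0..<m}. src i = v}"

text \<open>How many outgoing arcs must rule out a value before the node exceeds it: Alice is
  content with one usable arc, so all must fail; Bob picks the worst arc, so one suffices.\<close>

definition thr :: "int \<Rightarrow> int" where
  "thr v = (if al v then int (card (outs v)) else 1)"

definition votes :: "(int \<Rightarrow> int) \<Rightarrow> int \<Rightarrow> int \<Rightarrow> int" where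
  "votes lev v k = int (card {i \<in> outs v. k < lev i})"

definition ins_below :: "int \<Rightarrow> int \<Rightarrow> int" where
  "ins_below p v = int (card {i \<in> {0..<p}. tgt i = v})"

abbreviation indeg :: "int \<Rightarrow> int" where
  "indeg \<equiv> ins_below m"

text \<open>
  The arcs into a node form a linked list of decreasing arc numbers.  A pointer \<open>p\<close> stands
  for arc \<open>p - 1\<close>, and 0 is the null pointer.
\<close>

definition last_in :: "int \<Rightarrow> int \<Rightarrow> int \<Rightarrow> bool" where
  "last_in v h p \<longleftrightarrow> 0 \<le> p \<and> p \<le> h \<and> (0 < p \<longrightarrow> tgt (p - 1) = v) \<and>
     (\<forall>i. p \<le> i \<and> i < h \<longrightarrow> tgt i \<noteq> v)"

text \<open>The value of the target justifies the level \<open>e (tgt i) + d i\<close>, capped at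
  \<open>T\<close>, or the level \<open>T\<close> if that value is infinite; a raisable arc is still
  short of it.\<close>

definition raisable :: "(int \<Rightarrow> int) \<Rightarrow> (int \<Rightarrow> int) \<Rightarrow> int \<Rightarrow> bool" where
  "raisable e lev i \<longleftrightarrow> lev i < T \<and> (\<not> e (tgt i) < T \<or> lev i < e (tgt i) + d i)"

text \<open>The two excuses for a level to lag behind: the arc has not yet been passed in the list
  under traversal, or its target waits in the queue. The bound \<open>i < p\<close> includes arc
  \<open>p - 1\<close>, the one under inspection.\<close>

definition pending :: "(int \<Rightarrow> int) \<Rightarrow> int \<Rightarrow> int \<Rightarrow> int \<Rightarrow> int \<Rightarrow> bool" where
  "pending Q qh qt p i \<longleftrightarrow>
     (i < p \<and> tgt i = tgt (p - 1)) \<or> (\<exists>q. qh \<le> q \<and> q < qt \<and> Q q = tgt i)"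

text \<open>Queue cells are never reused: \<open>qt\<close> counts the \<open>n\<close> initial
  entries plus one per lift, which bounds the queue indices. The last conjunct makes the values
  stable once queue and list are exhausted, since then no arc is pending.\<close>

definition inv :: "(int \<Rightarrow> int) \<Rightarrow> (int \<Rightarrow> int) \<Rightarrow> (int \<Rightarrow> int) \<Rightarrow> (int \<Rightarrow> int) \<Rightarrow>
    int \<Rightarrow> int \<Rightarrow> int \<Rightarrow> bool" where
  "inv e lev cnt Q qh qt p \<longleftrightarrow>
     (\<forall>v\<in>{0..<n}. e v \<in> {0..T}) \<and> (\<forall>i\<in>{0..<m}. lev i \<in> {0..T}) \<and>
     (\<forall>v\<in>{0..<n}. \<forall>k\<in>{0..<T}. cnt (v * T + k) = votes lev v k) \<and>
     (\<forall>v\<in>{0..<n}. \<forall>k\<in>{0..<T}. k < e v \<longleftrightarrow> thr v \<le> votes lev v k) \<and>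
     (\<forall>i\<in>{0..<m}. \<forall>k\<in>{0..<lev i}. forced i k) \<and>
     (\<forall>v\<in>{0..<n}. \<forall>k\<in>{0..<e v}. Z v k) \<and>
     0 \<le> qh \<and> qh \<le> qt \<and> qt = n + (\<Sum>v\<in>{0..<n}. e v) \<and>
     (\<forall>q\<in>{0..<qt}. Q q \<in> {0..<n}) \<and> 0 \<le> p \<and> p \<le> m \<and>
     (\<forall>i\<in>{0..<m}. raisable e lev i \<longrightarrow> pending Q qh qt p i)"

lemma invI:
  assumes "\<And>v. 0 \<le> v \<Longrightarrow> v < n \<Longrightarrow> 0 \<le> e v \<and> e v \<le> T"
    and "\<And>i. 0 \<le> i \<Longrightarrow> i < m \<Longrightarrow> 0 \<le> lev i \<and> lev i \<le> T"
    and "\<And>v k. 0 \<le> v \<Longrightarrow> v < n \<Longrightarrow> 0 \<le> k \<Longrightarrow> k < T \<Longrightarrow> cnt (v * T + k) = votes lev v k"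
    and "\<And>v k. 0 \<le> v \<Longrightarrow> v < n \<Longrightarrow> 0 \<le> k \<Longrightarrow> k < T \<Longrightarrow> k < e v \<longleftrightarrow> thr v \<le> votes lev v k"
    and "\<And>i k. 0 \<le> i \<Longrightarrow> i < m \<Longrightarrow> 0 \<le> k \<Longrightarrow> k < lev i \<Longrightarrow> forced i k"
    and "\<And>v k. 0 \<le> v \<Longrightarrow> v < n \<Longrightarrow> 0 \<le> k \<Longrightarrow> k < e v \<Longrightarrow> Z v k"
    and "0 \<le> qh" "qh \<le> qt" "qt = n + (\<Sum>v\<in>{0..<n}. e v)"
    and "\<And>q. 0 \<le> q \<Longrightarrow> q < qt \<Longrightarrow> 0 \<le> Q q \<and> Q q < n"
    and "0 \<le> p" "p \<le> m"
    and "\<And>i. 0 \<le> i \<Longrightarrow> i < m \<Longrightarrow> raisable e lev i \<Longrightarrow> pending Q qh qt p i"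
  shows "inv e lev cnt Q qh qt p"
  unfolding inv_def by (intro conjI ballI impI) (use assms in simp_all)

lemma invD:
  assumes "inv e lev cnt Q qh qt p"
  shows inv_e: "\<And>v. 0 \<le> v \<Longrightarrow> v < n \<Longrightarrow> 0 \<le> e v \<and> e v \<le> T"
    and inv_lev: "\<And>i. 0 \<le> i \<Longrightarrow> i < m \<Longrightarrow> 0 \<le> lev i \<and> lev i \<le> T"
    and inv_cnt: "\<And>v k. 0 \<le> v \<Longrightarrow> v < n \<Longrightarrow> 0 \<le> k \<Longrightarrow> k < T \<Longrightarrow> cnt (v * T + k) = votes lev v k"
    and inv_votes: "\<And>v k. 0 \<le> v \<Longrightarrow> v < n \<Longrightarrow> 0 \<le> k \<Longrightarrow> k < T \<Longrightarrow>
      k < e v \<longleftrightarrow> thr v \<le> votes lev v k"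
    and inv_forced: "\<And>i k. 0 \<le> i \<Longrightarrow> i < m \<Longrightarrow> 0 \<le> k \<Longrightarrow> k < lev i \<Longrightarrow> forced i k"
    and inv_Z: "\<And>v k. 0 \<le> v \<Longrightarrow> v < n \<Longrightarrow> 0 \<le> k \<Longrightarrow> k < e v \<Longrightarrow> Z v k"
    and inv_q: "0 \<le> qh" "qh \<le> qt" "qt = n + (\<Sum>v\<in>{0..<n}. e v)"
    and inv_Q: "\<And>q. 0 \<le> q \<Longrightarrow> q < qt \<Longrightarrow> 0 \<le> Q q \<and> Q q < n"
    and inv_p: "0 \<le> p" "p \<le> m"
    and inv_pending: "\<And>i. 0 \<le> i \<Longrightarrow> i < m \<Longrightarrow> raisable e lev i \<Longrightarrow> pending Q qh qt p i"
  using assms unfolding inv_def by (elim conjE; simp)+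

text \<open>
  Every queue entry \<open>u\<close> and every future lift of \<open>u\<close> pays for one traversal of the arcs
  into \<open>u\<close>.
\<close>

definition potential :: "(int \<Rightarrow> int) \<Rightarrow> (int \<Rightarrow> int) \<Rightarrow> (int \<Rightarrow> int) \<Rightarrow> int \<Rightarrow> int \<Rightarrow> int \<Rightarrow> int" where
  "potential e lev Q qh qt p =
     (\<Sum>i\<in>{0..<m}. T - lev i) + (\<Sum>v\<in>{0..<n}. (T - e v) * (1 + indeg v)) +
     (\<Sum>q\<in>{qh..<qt}. 1 + indeg (Q q)) + ins_below p (tgt (p - 1))"

section \<open>Preservation of the invariant and decrease of the potential\<close>

lemma finite_outs: "finite (outs v)"
  by (rule finite_subset[of _ "{0..<m}"]) (auto simp: outs_def)

text \<open>Out-degree at least 1 enters here: zero votes never lift a node, as the initial values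
  require.\<close>

lemma thr_pos:
  assumes "0 \<le> v" "v < n" shows "1 \<le> thr v"
proof -
  have "outs v \<noteq> {}" using out[OF assms] by (auto simp: outs_def)
  then have "0 < card (outs v)" using finite_outs by (simp add: card_gt_0_iff)
  then show ?thesis by (simp add: thr_def)
qed

lemma votes_le: "votes lev v k \<le> m"
proof -
  have "card {i \<in> outs v. k < lev i} \<le> card {0..<m}"
    by (rule card_mono) (auto simp: outs_def)
  then show ?thesis using m_nonneg by (simp add: votes_def)
qed

lemma ins_below_nonneg: "0 \<le> ins_below p v"
  by (simp add: ins_below_def)

text \<open>Following a pointer skips only arcs with other targets, so the number of arcs still to
  visit is unchanged. At the null pointer \<open>tgt (p - 1)\<close> is a junk value, but both sides
  count nothing.\<close>

lemma ins_below_last_in: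
  assumes "last_in v h p" "0 \<le> h"
  shows "ins_below p (tgt (p - 1)) = ins_below h v"
proof (cases "p = 0")
  case True
  then have "{i \<in> {0..<h}. tgt i = v} = {}" "{i \<in> {0..<p}. tgt i = tgt (p - 1)} = {}"
    using assms by (auto simp: last_in_def)
  then show ?thesis unfolding ins_below_def by metis
next
  case False
  then have "tgt (p - 1) = v" using assms by (auto simp: last_in_def)
  moreover have "{i \<in> {0..<p}. tgt i = v} = {i \<in> {0..<h}. tgt i = v}"
    using assms by (force simp: last_in_def not_less)
  ultimately show ?thesis unfolding ins_below_def by metis
qed

lemma ins_below_Suc:
  assumes "0 < p"
  shows "ins_below p (tgt (p - 1)) = ins_below (p - 1) (tgt (p - 1)) + 1"
proof -
  let ?A = "{i \<in> {0..<p - 1}. tgt i = tgt (p - 1)}"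
  have eq: "{i \<in> {0..<p}. tgt i = tgt (p - 1)} = insert (p - 1) ?A"
    using assms by auto
  have "finite ?A" by (rule finite_subset[of _ "{0..<p - 1}"]) auto
  then have "card {i \<in> {0..<p}. tgt i = tgt (p - 1)} = Suc (card ?A)"
    unfolding eq by (rule card_insert_disjoint) simp
  then show ?thesis unfolding ins_below_def by linarith
qed

lemma potential_nonneg:
  assumes "inv e lev cnt Q qh qt p"
  shows "0 \<le> potential e lev Q qh qt p"
proof -
  have "0 \<le> (\<Sum>i\<in>{0..<m}. T - lev i)" "0 \<le> (\<Sum>v\<in>{0..<n}. (T - e v) * (1 + indeg v))"
    "0 \<le> (\<Sum>q\<in>{qh..<qt}. 1 + indeg (Q q))"
    using inv_e[OF assms] inv_lev[OF assms] ins_below_nonneg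
    by (auto intro!: sum_nonneg mult_nonneg_nonneg add_nonneg_nonneg)
  then show ?thesis using ins_below_nonneg unfolding potential_def by (metis add_nonneg_nonneg)
qed

text \<open>Removing the head of the queue releases \<open>1 + indeg\<close>: the in-degree pays for
  the list now to be traversed, and the 1 is the strict decrease. Arcs pending through the queue
  entry become pending through the list.\<close>

lemma load:
  assumes I: "inv e lev cnt Q qh qt 0" and q: "qh < qt" and h: "last_in (Q qh) m h"
  shows "inv e lev cnt Q (qh + 1) qt h"
    and "potential e lev Q (qh + 1) qt h < potential e lev Q qh qt 0"
proof -
  have p: "pending Q (qh + 1) qt h i"
    if i: "0 \<le> i" "i < m" "pending Q qh qt 0 i" for i
  proof -
    obtain r where r: "qh \<le> r" "r < qt" "Q r = tgt i" using i by (auto simp: pending_def)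
    show ?thesis
    proof (cases "r = qh")
      case True
      then have "i < h" using h r i by (force simp: last_in_def not_less)
      then show ?thesis using h r True i by (auto simp: pending_def last_in_def)
    next
      case False
      then show ?thesis using r by (auto simp: pending_def intro!: exI[of _ r])
    qed
  qed
  then show "inv e lev cnt Q (qh + 1) qt h"
    using q h inv_q[OF I]
    by (intro invI p)
      (rule inv_e[OF I] inv_lev[OF I] inv_cnt[OF I] inv_votes[OF I] inv_forced[OF I] inv_Z[OF I]
        inv_Q[OF I] inv_pending[OF I] | assumption | simp add: last_in_def)+
  have "{qh..<qt} = insert qh {qh + 1..<qt}" using q by auto
  then have "(\<Sum>q\<in>{qh..<qt}. 1 + indeg (Q q)) = 1 + indeg (Q qh) + (\<Sum>q\<in>{qh + 1..<qt}. 1 + indeg (Q q))"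
    by simp
  moreover have "ins_below h (tgt (h - 1)) = indeg (Q qh)"
    by (rule ins_below_last_in[OF h m_nonneg])
  ultimately show "potential e lev Q (qh + 1) qt h < potential e lev Q qh qt 0"
    by (simp add: potential_def ins_below_def)
qed

text \<open>An arc is passed only when it is not raisable, so no pending work is forgotten. The
  raises it may have undergone before are paid for by its level, not by the list.\<close>

lemma advance:
  assumes I: "inv e lev cnt Q qh qt p" and p: "0 < p" and nr: "\<not> raisable e lev (p - 1)"
    and h: "last_in (tgt (p - 1)) (p - 1) r"
  shows "inv e lev cnt Q qh qt r"
    and "potential e lev Q qh qt r < potential e lev Q qh qt p"
proof -
  have "pending Q qh qt r i" if i: "0 \<le> i" "i < m" "pending Q qh qt p i" "raisable e lev i" for i
  proof (cases "i < p \<and> tgt i = tgt (p - 1)")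
    case True
    then have "i < p - 1" using nr i by (cases "i = p - 1") auto
    then have "i < r" using h True by (auto simp: last_in_def not_less)
    then show ?thesis using h True i by (auto simp: pending_def last_in_def)
  next
    case False
    then show ?thesis using i by (auto simp: pending_def)
  qed
  then show "inv e lev cnt Q qh qt r"
    using invD[OF I] p h by (intro invI) (auto simp: last_in_def)
  have "ins_below r (tgt (r - 1)) = ins_below (p - 1) (tgt (p - 1))"
    by (rule ins_below_last_in[OF h]) (use p in auto)
  then show "potential e lev Q qh qt r < potential e lev Q qh qt p"
    using ins_below_Suc[OF p] by (simp add: potential_def)
qed

lemma votes_raise:
  assumes i: "0 \<le> i" "i < m"
  shows "votes (lev(i := lev i + 1)) v k =
    votes lev v k + (if v = src i \<and> k = lev i then 1 else 0)"
proof (cases "v = src i \<and> k = lev i")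
  case True
  then have "{j \<in> outs v. k < (lev(i := lev i + 1)) j} = insert i {j \<in> outs v. k < lev j}"
    using i by (auto simp: outs_def)
  then show ?thesis using True finite_outs by (simp add: votes_def)
next
  case False
  then have "{j \<in> outs v. k < (lev(i := lev i + 1)) j} = {j \<in> outs v. k < lev j}"
    by (auto simp: outs_def)
  then show ?thesis using False by (auto simp: votes_def)
qed

context
  fixes e lev cnt Q qh qt p i
  assumes I: "inv e lev cnt Q qh qt p" and i: "0 \<le> i" "i < m" and r: "raisable e lev i"
begin

lemma raise_bounds: "0 \<le> src i" "src i < n" "0 \<le> lev i" "lev i < T"
  using src[OF i] inv_lev[OF I i] r by (auto simp: raisable_def)

lemma raise_forced: "forced i (lev i)"
proof -
  have Z: "\<And>k. 0 \<le> k \<Longrightarrow> k < e (tgt i) \<Longrightarrow> Z (tgt i) k"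
    using inv_Z[OF I] tgt[OF i] by simp
  consider "T \<le> e (tgt i)" | "lev i < e (tgt i) + d i" using r by (auto simp: raisable_def)
  then show ?thesis
  proof cases
    case 1
    then show ?thesis using Z[of "T - 1"] raise_bounds by (auto simp: forced_def)
  next
    case 2
    then show ?thesis using Z[of "lev i - d i"] by (cases "lev i < d i") (auto simp: forced_def)
  qed
qed

lemma raise_cnt:
  assumes "0 \<le> v" "v < n" "0 \<le> k" "k < T"
  shows "(cnt(src i * T + lev i := cnt (src i * T + lev i) + 1)) (v * T + k) =
    votes (lev(i := lev i + 1)) v k"
proof -
  have "cnt (v * T + k) = votes lev v k" by (rule inv_cnt[OF I assms])
  then show ?thesis
    using index_inject[of v T k "src i" "lev i"] raise_bounds assms
    by (auto simp: votes_raise[OF i])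
qed

lemma raise_forced_below:
  assumes "0 \<le> j" "j < m" "0 \<le> k" "k < (lev(i := lev i + 1)) j"
  shows "forced j k"
proof (cases "j = i \<and> k = lev i")
  case True
  then show ?thesis using raise_forced by simp
next
  case False
  then have "k < lev j" using assms by (auto split: if_splits)
  then show ?thesis by (rule inv_forced[OF I assms(1-3)])
qed

lemma raise_sum: "(\<Sum>j\<in>{0..<m}. T - (lev(i := lev i + 1)) j) = (\<Sum>j\<in>{0..<m}. T - lev j) - 1"
  by (subst sum_eq_except[where f = "\<lambda>j. T - lev j" and a = i]) (use i in auto)

lemma raise_raisable:
  "raisable e (lev(i := lev i + 1)) j \<Longrightarrow> raisable e lev j"
  using r by (auto simp: raisable_def split: if_splits)

text \<open>Counters grow by one at a time, so the test for equality detects the moment a threshold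
  is met: below it nothing is lifted, and above it the node was lifted before.\<close>

lemma raise:
  assumes "cnt (src i * T + lev i) + 1 \<noteq> thr (src i)"
  shows "inv e (lev(i := lev i + 1)) (cnt(src i * T + lev i := cnt (src i * T + lev i) + 1)) Q qh qt p"
    and "potential e (lev(i := lev i + 1)) Q qh qt p < potential e lev Q qh qt p"
proof -
  have "votes lev (src i) (lev i) + 1 \<noteq> thr (src i)"
    using assms inv_cnt[OF I raise_bounds] by simp
  then have "thr v \<le> votes (lev(i := lev i + 1)) v k \<longleftrightarrow> thr v \<le> votes lev v k" for v k
    by (auto simp: votes_raise[OF i])
  then show "inv e (lev(i := lev i + 1))
      (cnt(src i * T + lev i := cnt (src i * T + lev i) + 1)) Q qh qt p"
    using invD[OF I] raise_cnt raise_forced_below raise_raisable raise_bounds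
    by (intro invI) (simp_all del: fun_upd_apply, simp)
  show "potential e (lev(i := lev i + 1)) Q qh qt p < potential e lev Q qh qt p"
    unfolding potential_def raise_sum by simp
qed

context
  assumes eq: "cnt (src i * T + lev i) + 1 = thr (src i)"
begin

lemma lift_votes: "votes lev (src i) (lev i) + 1 = thr (src i)"
  using eq inv_cnt[OF I raise_bounds] by simp

text \<open>An arc that rules out a value also rules out all smaller ones. Were
  \<open>e (src i)\<close> below \<open>lev i\<close>, the arcs voting against \<open>lev i\<close>
  together with \<open>i\<close> itself would already meet the threshold at
  \<open>e (src i)\<close>. Hence values are exceeded in order, and a lift by 1 is exact.\<close>

lemma lift_value: "e (src i) = lev i"
proof -
  have iff: "\<And>k. 0 \<le> k \<Longrightarrow> k < T \<Longrightarrow> k < e (src i) \<longleftrightarrow> thr (src i) \<le> votes lev (src i) k"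
    and e: "0 \<le> e (src i)"
    using inv_votes[OF I raise_bounds(1,2)] inv_e[OF I raise_bounds(1,2)] by blast+
  have "\<not> lev i < e (src i)" using iff[of "lev i"] lift_votes raise_bounds by auto
  moreover have "\<not> e (src i) < lev i"
  proof
    assume lt: "e (src i) < lev i"
    have "insert i {j \<in> outs (src i). lev i < lev j} \<subseteq> {j \<in> outs (src i). e (src i) < lev j}"
      using lt i by (auto simp: outs_def)
    then have "card (insert i {j \<in> outs (src i). lev i < lev j}) \<le>
        card {j \<in> outs (src i). e (src i) < lev j}"
      using finite_outs by (intro card_mono) auto
    then have "thr (src i) \<le> votes lev (src i) (e (src i))"
      using lift_votes finite_outs by (simp add: votes_def)
    then show False using iff[of "e (src i)"] e lt raise_bounds by auto
  qed
  ultimately show ?thesis by simp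
qed

text \<open>The term \<open>(T - e v) * (1 + indeg v)\<close> drops by exactly the cost of the new
  queue entry; the strict decrease comes from the raised level.\<close>

lemma lift:
  assumes alice: "al (src i) \<Longrightarrow> (\<And>j. 0 \<le> j \<Longrightarrow> j < m \<Longrightarrow> src j = src i \<Longrightarrow> forced j (lev i)) \<Longrightarrow>
      Z (src i) (lev i)"
    and bob: "\<not> al (src i) \<Longrightarrow> forced i (lev i) \<Longrightarrow> Z (src i) (lev i)"
  defines "e' \<equiv> e(src i := e (src i) + 1)" and "lev' \<equiv> lev(i := lev i + 1)"
  shows "inv e' lev' (cnt(src i * T + lev i := cnt (src i * T + lev i) + 1))
      (Q(qt := src i)) qh (qt + 1) p" (is ?inv)
    and "potential e' lev' (Q(qt := src i)) qh (qt + 1) p < potential e lev Q qh qt p" (is ?pot)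
proof -
  note q = inv_q[OF I]
  have e_src: "e' (src i) = lev i + 1" and e_other: "\<And>v. v \<noteq> src i \<Longrightarrow> e' v = e v"
    using lift_value by (auto simp: e'_def)
  have "Z (src i) (lev i)"
  proof (cases "al (src i)")
    case True
    \<comment> \<open>For Alice the threshold is the out-degree, so meeting it means that every
      outgoing arc rules out \<open>lev i\<close>.\<close>
    have "{j \<in> outs (src i). lev i < lev' j} = outs (src i)"
    proof (rule card_subset_eq[OF finite_outs])
      have "votes lev' (src i) (lev i) = thr (src i)"
        using lift_votes votes_raise[OF i, of lev "src i" "lev i"] by (simp add: lev'_def)
      then show "card {j \<in> outs (src i). lev i < lev' j} = card (outs (src i))"
        using True by (simp add: votes_def thr_def)
    qed auto
    then have "forced j (lev i)" if "0 \<le> j" "j < m" "src j = src i" for j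
      using raise_forced_below[of j "lev i"] that raise_bounds
      unfolding outs_def lev'_def by (auto simp del: fun_upd_apply)
    then show ?thesis using alice True by blast
  next
    case False
    then show ?thesis using bob raise_forced by blast
  qed
  then have Z: "Z v k" if "0 \<le> v" "v < n" "0 \<le> k" "k < e' v" for v k
  proof (cases "v = src i \<and> k = lev i")
    case False
    then have "k < e v" using that e_src e_other lift_value by (cases "v = src i") auto
    then show ?thesis using inv_Z[OF I] that by blast
  qed auto
  have thr: "k < e' v \<longleftrightarrow> thr v \<le> votes lev' v k" if "0 \<le> v" "v < n" "0 \<le> k" "k < T" for v k
  proof -
    have old: "k < e v \<longleftrightarrow> thr v \<le> votes lev v k" by (rule inv_votes[OF I that])
    have new: "votes lev' v k = votes lev v k + (if v = src i \<and> k = lev i then 1 else 0)"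
      unfolding lev'_def by (rule votes_raise[OF i])
    show ?thesis
    proof (cases "v = src i \<and> k = lev i")
      case True
      then show ?thesis using new lift_votes e_src by simp
    next
      case False
      then have "k < e' v \<longleftrightarrow> k < e v" using e_src e_other lift_value by (cases "v = src i") auto
      then show ?thesis using old new False by simp
    qed
  qed
  \<comment> \<open>Only arcs into the lifted node can become raisable, and that node has just been
    queued.\<close>
  have pend: "pending (Q(qt := src i)) qh (qt + 1) p j"
    if "0 \<le> j" "j < m" "raisable e' lev' j" for j
  proof (cases "tgt j = src i")
    case True
    then show ?thesis using q by (auto simp: pending_def intro!: exI[of _ qt])
  next
    case False
    then have "raisable e lev' j" using that e_other by (simp add: raisable_def)
    then have "raisable e lev j" using raise_raisable by (simp add: lev'_def)
    then have "pending Q qh qt p j" by (rule inv_pending[OF I that(1,2)])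
    then show ?thesis unfolding pending_def by fastforce
  qed
  have sum_e: "(\<Sum>v\<in>{0..<n}. e' v) = (\<Sum>v\<in>{0..<n}. e v) + 1"
    by (subst sum_eq_except[where f = e and a = "src i"]) (use raise_bounds in \<open>auto simp: e'_def\<close>)
  show ?inv
  proof (rule invI)
    show "0 \<le> e' v \<and> e' v \<le> T" if "0 \<le> v" "v < n" for v
      using inv_e[OF I that] raise_bounds lift_value by (auto simp: e'_def)
    show "0 \<le> lev' j \<and> lev' j \<le> T" if "0 \<le> j" "j < m" for j
      using inv_lev[OF I that] raise_bounds by (auto simp: lev'_def)
    show "(cnt(src i * T + lev i := cnt (src i * T + lev i) + 1)) (v * T + k) = votes lev' v k"
      if "0 \<le> v" "v < n" "0 \<le> k" "k < T" for v k
      unfolding lev'_def by (rule raise_cnt[OF that])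
    show "forced j k" if "0 \<le> j" "j < m" "0 \<le> k" "k < lev' j" for j k
      using raise_forced_below that unfolding lev'_def by blast
    show "0 \<le> (Q(qt := src i)) r \<and> (Q(qt := src i)) r < n" if "0 \<le> r" "r < qt + 1" for r
      using inv_Q[OF I, of r] raise_bounds that by auto
  qed (use Z thr pend sum_e q inv_p[OF I] in simp_all)
  have "(T - e' (src i)) * c - (T - e (src i)) * c = - c" for c
    by (simp add: e'_def algebra_simps)
  then have "(\<Sum>v\<in>{0..<n}. (T - e' v) * (1 + indeg v)) =
      (\<Sum>v\<in>{0..<n}. (T - e v) * (1 + indeg v)) - (1 + indeg (src i))"
    using sum_eq_except[of "{0..<n}" "src i" "\<lambda>v. (T - e' v) * (1 + indeg v)"
        "\<lambda>v. (T - e v) * (1 + indeg v)"] raise_bounds e_other by simp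
  moreover have "(\<Sum>q\<in>{qh..<qt + 1}. 1 + indeg ((Q(qt := src i)) q)) =
      (\<Sum>q\<in>{qh..<qt}. 1 + indeg (Q q)) + (1 + indeg (src i))"
  proof -
    have "{qh..<qt + 1} = insert qt {qh..<qt}" using q by auto
    moreover have "(\<Sum>q\<in>{qh..<qt}. 1 + indeg ((Q(qt := src i)) q)) = (\<Sum>q\<in>{qh..<qt}. 1 + indeg (Q q))"
      by (rule sum.cong) auto
    ultimately show ?thesis by simp
  qed
  ultimately show ?pot unfolding potential_def lev'_def raise_sum by simp
qed

end

end

text \<open>With nothing pending, no arc is raisable. Since \<open>v\<close> does not exceed its own
  value \<open>e v\<close>, some outgoing arc has \<open>lev i \<le> e v < T\<close>, and not being
  raisable it satisfies the inequality. For Bob no outgoing arc votes against \<open>e v\<close>, so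
  all of them do.\<close>

lemma stable_alice:
  assumes I: "inv e lev cnt Q qh qt 0" and q: "\<not> qh < qt"
    and v: "0 \<le> v" "v < n" "al v" "e v < T"
  shows "\<exists>i. 0 \<le> i \<and> i < m \<and> src i = v \<and> e (tgt i) < T \<and> e (tgt i) \<le> e v - d i"
proof -
  have e: "0 \<le> e v" and iff: "\<And>k. 0 \<le> k \<Longrightarrow> k < T \<Longrightarrow> k < e v \<longleftrightarrow> thr v \<le> votes lev v k"
    and stable: "\<And>i. 0 \<le> i \<Longrightarrow> i < m \<Longrightarrow> \<not> raisable e lev i"
    using inv_e[OF I v(1,2)] inv_votes[OF I v(1,2)] inv_pending[OF I] q
    by (blast, blast, fastforce simp: pending_def)
  have "votes lev v (e v) < thr v" using iff[OF e v(4)] by simp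
  then have "{j \<in> outs v. e v < lev j} \<noteq> outs v" using v(3) by (auto simp: votes_def thr_def)
  then obtain i where "i \<in> outs v" "lev i \<le> e v" by force
  then show ?thesis using stable[of i] v by (auto simp: outs_def raisable_def intro!: exI[of _ i])
qed

lemma stable_bob:
  assumes I: "inv e lev cnt Q qh qt 0" and q: "\<not> qh < qt"
    and v: "0 \<le> v" "v < n" "\<not> al v" "e v < T" and i: "0 \<le> i" "i < m" "src i = v"
  shows "e (tgt i) < T \<and> e (tgt i) \<le> e v - d i"
proof -
  have e: "0 \<le> e v" and iff: "\<And>k. 0 \<le> k \<Longrightarrow> k < T \<Longrightarrow> k < e v \<longleftrightarrow> thr v \<le> votes lev v k"
    and stable: "\<And>i. 0 \<le> i \<Longrightarrow> i < m \<Longrightarrow> \<not> raisable e lev i"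
    using inv_e[OF I v(1,2)] inv_votes[OF I v(1,2)] inv_pending[OF I] q
    by (blast, blast, fastforce simp: pending_def)
  have "votes lev v (e v) < 1" using iff[OF e v(4)] v(3) by (simp add: thr_def)
  then have "{j \<in> outs v. e v < lev j} = {}" using finite_outs by (simp add: votes_def)
  then have "lev i \<le> e v" using i by (auto simp: outs_def)
  then show ?thesis using stable[of i] v i by (auto simp: raisable_def)
qed

text \<open>All nodes start in the queue because arcs with \<open>d i > 0\<close> can be raisable
  before any value has changed.\<close>

lemma inv_init:
  assumes "\<And>q. 0 \<le> q \<Longrightarrow> q < n \<Longrightarrow> Q q = q"
  shows "inv (\<lambda>_. 0) (\<lambda>_. 0) (\<lambda>_. 0) Q 0 n 0"
proof -
  have "votes (\<lambda>_. 0) v k = 0" if "0 \<le> k" for v k using that by (simp add: votes_def)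
  moreover have "pending Q 0 n 0 i" if "0 \<le> i" "i < m" for i
    using assms tgt[OF that] by (auto simp: pending_def intro!: exI[of _ "tgt i"])
  moreover have "\<not> thr v \<le> 0" if "0 \<le> v" "v < n" for v using thr_pos that by fastforce
  ultimately show ?thesis
    using assms n_nonneg m_nonneg T_nonneg by (intro invI) auto
qed

lemma sum_indeg: "(\<Sum>v\<in>{0..<n}. indeg v) = m"
proof -
  have "(\<Sum>v\<in>{0..<n}. card {i \<in> {0..<m}. tgt i = v}) = card (\<Union>v\<in>{0..<n}. {i \<in> {0..<m}. tgt i = v})"
    by (rule card_UN_disjoint[symmetric]) (auto intro: finite_subset[of _ "{0..<m}"])
  also have "(\<Union>v\<in>{0..<n}. {i \<in> {0..<m}. tgt i = v}) = {0..<m}" using tgt by auto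
  finally show ?thesis using m_nonneg unfolding ins_below_def by (simp flip: of_nat_sum)
qed

text \<open>The levels contribute \<open>m * T\<close>, the possible lifts
  \<open>T * (n + m)\<close>, and the initial queue \<open>n + m\<close>.\<close>

lemma potential_init:
  assumes "\<And>q. 0 \<le> q \<Longrightarrow> q < n \<Longrightarrow> Q q = q"
  shows "potential (\<lambda>_. 0) (\<lambda>_. 0) Q 0 n 0 = m * T + (T + 1) * (n + m)"
proof -
  have "(\<Sum>q\<in>{0..<n}. 1 + indeg (Q q)) = (\<Sum>q\<in>{0..<n}. 1 + indeg q)"
    using assms by (intro sum.cong) auto
  moreover have "(\<Sum>v\<in>{0..<n}. T * (1 + indeg v)) = T * (n + m)"
    unfolding sum_distrib_left[symmetric] sum.distrib sum_indeg using n_nonneg by simp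
  ultimately show ?thesis
    using n_nonneg m_nonneg sum_indeg
    by (simp add: potential_def sum.distrib ins_below_def algebra_simps)
qed

end

section \<open>The program\<close>

text \<open>If \<open>M\<close> is negative, no energy is finite; with \<open>T\<close> clamped to 0
  every output is then infinite.\<close>

definition setup_prog :: com where
  "setup_prog =
     Seq (Assign ''B'' (Quot (Var ''c'') (Var ''n'')))
    (Seq (Assign ''T'' (Add (Quot (Var ''M'') (Var ''B'')) (Const 1)))
         (Cond (Less (Var ''T'') (Const 0)) (Assign ''T'' (Const 0)) Skip))"

definition link_guard :: bexp where
  "link_guard = Less (Var ''i'') (Var ''m'')"

definition link_body :: com where
  "link_body =
     Seq (Write ''next'' (Var ''i'') (Read ''head'' (Read ''target'' (Var ''i''))))
    (Seq (Write ''head'' (Read ''target'' (Var ''i'')) (Add (Var ''i'') (Const 1)))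
    (Seq (Cond (Less (Const 0) (Read ''alice'' (Read ''source'' (Var ''i''))))
           (Write ''thr'' (Read ''source'' (Var ''i''))
             (Add (Read ''thr'' (Read ''source'' (Var ''i''))) (Const 1)))
           (Write ''thr'' (Read ''source'' (Var ''i'')) (Const 1)))
         (Assign ''i'' (Add (Var ''i'') (Const 1)))))"

definition queue_guard :: bexp where
  "queue_guard = Less (Var ''qt'') (Var ''n'')"

definition queue_body :: com where
  "queue_body =
     Seq (Write ''queue'' (Var ''qt'') (Var ''qt''))
         (Assign ''qt'' (Add (Var ''qt'') (Const 1)))"

definition lift_guard :: bexp where
  "lift_guard = Neg (Conj (Less (Var ''p'') (Const 1)) (Neg (Less (Var ''qh'') (Var ''qt''))))"

definition raisable_test :: bexp where
  "raisable_test =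
     Conj (Less (Read ''lev'' (Var ''i'')) (Var ''T''))
       (Neg (Conj (Less (Read ''e'' (Read ''target'' (Var ''i''))) (Var ''T''))
         (Neg (Less (Read ''lev'' (Var ''i''))
           (Add (Read ''e'' (Read ''target'' (Var ''i'')))
             (Quot (Sub (Const 0) (Read ''weight'' (Var ''i''))) (Var ''B'')))))))"

definition raise_prog :: com where
  "raise_prog =
     Seq (Assign ''u'' (Read ''source'' (Var ''i'')))
    (Seq (Assign ''k'' (Add (Mul (Var ''u'') (Var ''T'')) (Read ''lev'' (Var ''i''))))
    (Seq (Write ''lev'' (Var ''i'') (Add (Read ''lev'' (Var ''i'')) (Const 1)))
    (Seq (Write ''cnt'' (Var ''k'') (Add (Read ''cnt'' (Var ''k'')) (Const 1)))
         (Cond (Conj (Neg (Less (Read ''cnt'' (Var ''k'')) (Read ''thr'' (Var ''u''))))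
                     (Neg (Less (Read ''thr'' (Var ''u'')) (Read ''cnt'' (Var ''k'')))))
           (Seq (Write ''e'' (Var ''u'') (Add (Read ''e'' (Var ''u'')) (Const 1)))
           (Seq (Write ''queue'' (Var ''qt'') (Var ''u''))
                (Assign ''qt'' (Add (Var ''qt'') (Const 1)))))
           Skip))))"

definition lift_body :: com where
  "lift_body =
     Cond (Less (Var ''p'') (Const 1))
       (Seq (Assign ''p'' (Read ''head'' (Read ''queue'' (Var ''qh''))))
            (Assign ''qh'' (Add (Var ''qh'') (Const 1))))
       (Seq (Assign ''i'' (Sub (Var ''p'') (Const 1)))
            (Cond raisable_test raise_prog (Assign ''p'' (Read ''next'' (Var ''i'')))))"

definition output_guard :: bexp where
  "output_guard = Less (Var ''j'') (Var ''n'')"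

definition output_body :: com where
  "output_body =
     Seq (Cond (Less (Read ''e'' (Var ''j'')) (Var ''T''))
           (Write ''energy'' (Var ''j'') (Mul (Var ''B'') (Read ''e'' (Var ''j''))))
           (Write ''energy'' (Var ''j'') (Const (- 1))))
         (Assign ''j'' (Add (Var ''j'') (Const 1)))"

definition energy_prog :: com where
  "energy_prog =
     Seq setup_prog
    (Seq (Loop link_guard link_body)
    (Seq (Loop queue_guard queue_body)
    (Seq (Loop lift_guard lift_body)
         (Loop output_guard output_body))))"

definition prog_cost :: nat where
  "prog_cost = 4 + cost setup_prog + 2 * (1 + bcost link_guard + cost link_body) +
     2 * (1 + bcost queue_guard + cost queue_body) + 4 * (1 + bcost lift_guard + cost lift_body) +
     2 * (1 + bcost output_guard + cost output_body)"

locale energy_run =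
  lifting n m T src tgt "\<lambda>i. (- wt i) div B" "\<lambda>v. 0 < ar v" Z
  for n m T :: int and src tgt wt :: "int \<Rightarrow> int" and B :: int and ar :: "int \<Rightarrow> int"
    and Z :: "int \<Rightarrow> int \<Rightarrow> bool" +
  fixes M c U :: int
  assumes n_pos: "1 \<le> n" and n_le_m: "n \<le> m" and B_pos: "1 \<le> B"
    and B_def: "B = c div n" and T_def: "T = max 0 (M div B + 1)"
    and ar_bit: "\<And>v. ar v \<in> {0..1}"
    and fits: "n + n * T + 1 \<le> U" "m + 1 \<le> U" "\<And>i. \<bar>wt i\<bar> + T \<le> U" "B * T \<le> U"
      "\<bar>M\<bar> + 1 \<le> U" "\<bar>c\<bar> \<le> U"
    and forced_alice: "\<And>v k. 0 \<le> v \<Longrightarrow> v < n \<Longrightarrow> 0 < ar v \<Longrightarrow> 0 \<le> k \<Longrightarrow> k < T \<Longrightarrow>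
      (\<And>i. 0 \<le> i \<Longrightarrow> i < m \<Longrightarrow> src i = v \<Longrightarrow> forced i k) \<Longrightarrow> Z v k"
    and forced_bob: "\<And>i k. 0 \<le> i \<Longrightarrow> i < m \<Longrightarrow> \<not> 0 < ar (src i) \<Longrightarrow> 0 \<le> k \<Longrightarrow> k < T \<Longrightarrow>
      forced i k \<Longrightarrow> Z (src i) k"
begin

definition static :: "state \<Rightarrow> bool" where
  "static s \<longleftrightarrow> vars s ''n'' = n \<and> vars s ''m'' = m \<and> vars s ''B'' = B \<and> vars s ''T'' = T \<and>
     arrays s ''source'' = src \<and> arrays s ''target'' = tgt \<and> arrays s ''weight'' = wt \<and>
     arrays s ''alice'' = ar"

definition fresh :: "state \<Rightarrow> bool" where
  "fresh s \<longleftrightarrow> vars s ''qh'' = 0 \<and> vars s ''p'' = 0 \<and> vars s ''j'' = 0 \<and>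
     arrays s ''e'' = (\<lambda>_. 0) \<and> arrays s ''lev'' = (\<lambda>_. 0) \<and> arrays s ''cnt'' = (\<lambda>_. 0)"

definition linked :: "int \<Rightarrow> state \<Rightarrow> bool" where
  "linked h s \<longleftrightarrow> (\<forall>v. 0 \<le> v \<and> v < n \<longrightarrow> last_in v h (arrays s ''head'' v)) \<and>
     (\<forall>j. 0 \<le> j \<and> j < h \<longrightarrow> last_in (tgt j) j (arrays s ''next'' j))"

definition thr_below :: "int \<Rightarrow> int \<Rightarrow> int" where
  "thr_below h v = (if 0 < ar v then int (card {j \<in> {0..<h}. src j = v})
     else if \<exists>j. 0 \<le> j \<and> j < h \<and> src j = v then 1 else 0)"

lemma fits': "n \<le> U" "m \<le> U" "T + 1 \<le> U" "B \<le> U" "1 \<le> U" "n * T \<le> U" "n + n * T \<le> U"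
  "0 \<le> n * T"
proof -
  have "T \<le> n * T" using mult_right_mono[OF n_pos T_nonneg] by simp
  moreover show "0 \<le> n * T" using n_pos T_nonneg by simp
  ultimately show "n \<le> U" "m \<le> U" "T + 1 \<le> U" "1 \<le> U" "n * T \<le> U" "n + n * T \<le> U"
    using fits n_pos T_nonneg by linarith+
  have "B * 1 \<le> B * n" using n_pos B_pos by (intro mult_left_mono) auto
  also have "B * n \<le> c" using n_pos by (simp add: B_def mult.commute[of _ n] pos_mod_sign minus_mod_eq_mult_div[symmetric])
  finally show "B \<le> U" using fits(6) by simp
qed

lemma thr_below_bounds:
  assumes "0 \<le> h" shows "0 \<le> thr_below h v" "thr_below h v \<le> max 1 h"
proof -
  have "card {j \<in> {0..<h}. src j = v} \<le> card {0..<h}" by (rule card_mono) auto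
  then show "0 \<le> thr_below h v" "thr_below h v \<le> max 1 h"
    using assms by (auto simp: thr_below_def)
qed

lemma thr_below_Suc:
  assumes "0 \<le> h"
  shows "thr_below (h + 1) v =
    (if v = src h then if 0 < ar v then thr_below h v + 1 else 1 else thr_below h v)"
proof -
  have fin: "finite {j. 0 \<le> j \<and> j < h \<and> src j = v}"
    by (rule finite_subset[of _ "{0..<h}"]) auto
  show ?thesis
  proof (cases "v = src h")
    case True
    then have "{j \<in> {0..<h + 1}. src j = v} = insert h {j. 0 \<le> j \<and> j < h \<and> src j = v}"
      using assms by auto
    then have "card {j \<in> {0..<h + 1}. src j = v} = Suc (card {j. 0 \<le> j \<and> j < h \<and> src j = v})"
      using fin by simp
    then show ?thesis using True assms by (auto simp: thr_below_def)
  next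
    case False
    then have "{j \<in> {0..<h + 1}. src j = v} = {j \<in> {0..<h}. src j = v}"
      by (auto simp: order_le_less)
    then show ?thesis using False by (auto simp: thr_below_def order_le_less)
  qed
qed

lemma thr_below_m:
  assumes "0 \<le> v" "v < n" shows "thr_below m v = thr v"
  using out[OF assms] by (auto simp: thr_below_def thr_def outs_def)

lemma last_in_Suc:
  assumes "last_in v h p" "0 \<le> h"
  shows "last_in v (h + 1) (if v = tgt h then h + 1 else p)"
proof (cases "v = tgt h")
  case True
  then show ?thesis using assms by (auto simp: last_in_def)
next
  case False
  then show ?thesis using assms by (auto simp: last_in_def order_le_less)
qed

definition link_inv :: "state \<Rightarrow> bool" where
  "link_inv s \<longleftrightarrow> static s \<and> fresh s \<and> vars s ''qt'' = 0 \<and>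
     0 \<le> vars s ''i'' \<and> vars s ''i'' \<le> m \<and> linked (vars s ''i'') s \<and>
     (\<forall>v. 0 \<le> v \<and> v < n \<longrightarrow> arrays s ''thr'' v = thr_below (vars s ''i'') v)"

lemma link_loop:
  assumes "link_inv s"
  shows "\<exists>t s'. exec U (Loop link_guard link_body) s t s' \<and>
    t \<le> (nat (m - vars s ''i'') + 1) * (1 + bcost link_guard + cost link_body) \<and>
    link_inv s' \<and> \<not> bval s' link_guard"
proof (rule loop_sound[where \<mu> = "\<lambda>s. nat (m - vars s ''i'')"])
  show "bfits U s link_guard" if "link_inv s" for s
    using that fits' by (auto simp: link_guard_def afits_def link_inv_def static_def)
next
  fix s assume I: "link_inv s" and b: "bval s link_guard"
  define i where "i = vars s ''i''"
  have i: "0 \<le> i" "i < m" using I b by (auto simp: link_inv_def link_guard_def static_def i_def)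
  note v = src[OF i] tgt[OF i]
  have st: "vars s ''m'' = m" "arrays s ''source'' = src" "arrays s ''target'' = tgt"
    "arrays s ''alice'' = ar" using I by (auto simp: link_inv_def static_def)
  have L: "\<And>v. 0 \<le> v \<Longrightarrow> v < n \<Longrightarrow> last_in v i (arrays s ''head'' v)"
    "\<And>j. 0 \<le> j \<Longrightarrow> j < i \<Longrightarrow> last_in (tgt j) j (arrays s ''next'' j)"
    using I by (auto simp: link_inv_def linked_def i_def)
  have thr: "\<And>v. 0 \<le> v \<Longrightarrow> v < n \<Longrightarrow> arrays s ''thr'' v = thr_below i v"
    using I by (auto simp: link_inv_def i_def)
  have head: "0 \<le> arrays s ''head'' (tgt i)" "arrays s ''head'' (tgt i) \<le> i"
    using L(1)[of "tgt i"] v by (auto simp: last_in_def)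
  have ti: "0 \<le> arrays s ''thr'' (src i)" "arrays s ''thr'' (src i) \<le> max 1 i"
    using thr[of "src i"] thr_below_bounds[OF i(1)] v by auto
  have bounds: "\<bar>i\<bar> \<le> U" "\<bar>i + 1\<bar> \<le> U" "\<bar>tgt i\<bar> \<le> U" "\<bar>src i\<bar> \<le> U"
    "\<bar>arrays s ''head'' (tgt i)\<bar> \<le> U" "\<bar>arrays s ''thr'' (src i)\<bar> \<le> U"
    "\<bar>arrays s ''thr'' (src i) + 1\<bar> \<le> U" "\<bar>ar (src i)\<bar> \<le> U" "1 \<le> U" "0 \<le> U"
    using i v head ti fits fits' n_pos n_le_m ar_bit[of "src i"] by auto
  have linked': "last_in w (i + 1) (if w = tgt i then i + 1 else arrays s ''head'' w)"
    if "0 \<le> w" "w < n" for w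
    using last_in_Suc[OF L(1)[OF that] i(1)] .
  have next': "last_in (tgt j) j (if j = i then arrays s ''head'' (tgt i) else arrays s ''next'' j)"
    if "0 \<le> j" "j < i + 1" for j
    using L(2)[of j] L(1)[of "tgt i"] v that by auto
  show "wp U link_body (\<lambda>s'. link_inv s' \<and> nat (m - vars s' ''i'') < nat (m - vars s ''i'')) s"
    using I i bounds linked' next'
    by (simp add: link_body_def afits_def i_def[symmetric] st link_inv_def static_def fresh_def
        linked_def thr_below_Suc thr[symmetric] v)
qed (rule assms)

definition queue_inv :: "state \<Rightarrow> bool" where
  "queue_inv s \<longleftrightarrow> static s \<and> fresh s \<and> linked m s \<and>
     (\<forall>v. 0 \<le> v \<and> v < n \<longrightarrow> arrays s ''thr'' v = thr v) \<and>
     0 \<le> vars s ''qt'' \<and> vars s ''qt'' \<le> n \<and>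
     (\<forall>q. 0 \<le> q \<and> q < vars s ''qt'' \<longrightarrow> arrays s ''queue'' q = q)"

lemma queue_loop:
  assumes "queue_inv s"
  shows "\<exists>t s'. exec U (Loop queue_guard queue_body) s t s' \<and>
    t \<le> (nat (n - vars s ''qt'') + 1) * (1 + bcost queue_guard + cost queue_body) \<and>
    queue_inv s' \<and> \<not> bval s' queue_guard"
proof (rule loop_sound[where \<mu> = "\<lambda>s. nat (n - vars s ''qt'')"])
  show "bfits U s queue_guard" if "queue_inv s" for s
    using that fits' by (auto simp: queue_guard_def afits_def queue_inv_def static_def)
next
  fix s assume I: "queue_inv s" and b: "bval s queue_guard"
  have "vars s ''qt'' < n" using I b by (auto simp: queue_inv_def queue_guard_def static_def)
  then show "wp U queue_body (\<lambda>s'. queue_inv s' \<and> nat (n - vars s' ''qt'') < nat (n - vars s ''qt'')) s"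
    using I fits' by (auto simp: queue_body_def afits_def queue_inv_def static_def fresh_def linked_def)
qed (rule assms)

definition lift_inv :: "state \<Rightarrow> bool" where
  "lift_inv s \<longleftrightarrow> static s \<and> linked m s \<and> (\<forall>v. 0 \<le> v \<and> v < n \<longrightarrow> arrays s ''thr'' v = thr v) \<and>
     vars s ''j'' = 0 \<and> inv (arrays s ''e'') (arrays s ''lev'') (arrays s ''cnt'') (arrays s ''queue'')
       (vars s ''qh'') (vars s ''qt'') (vars s ''p'')"

definition state_potential :: "state \<Rightarrow> nat" where
  "state_potential s = nat (potential (arrays s ''e'') (arrays s ''lev'') (arrays s ''queue'')
     (vars s ''qh'') (vars s ''qt'') (vars s ''p''))"

lemma qt_le:
  assumes "inv e lev cnt Q qh qt p"
  shows "qt \<le> n + n * T"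
proof -
  have "(\<Sum>v\<in>{0..<n}. e v) \<le> (\<Sum>v\<in>{0..<n}. T)"
    by (rule sum_mono) (use inv_e[OF assms] in auto)
  then show ?thesis using inv_q(3)[OF assms] n_nonneg by simp
qed

lemma abs_div_le: "\<bar>(- x) div B\<bar> \<le> \<bar>x\<bar>" for x
proof (cases "x \<le> 0")
  case True
  then have "0 \<le> (- x) div B" "(- x) div B \<le> - x"
    using B_pos zdiv_mono2[of "- x" 1 B] by (auto simp: pos_imp_zdiv_nonneg_iff)
  then show ?thesis using True by simp
next
  case False
  then have "(- x) div B \<le> 0" "- x \<le> (- x) div B"
    using B_pos zdiv_mono2_neg[of "- x" 1 B] by (auto simp: div_nonpos_pos_le0)
  then show ?thesis using False by simp
qed

lemma lift_step:
  assumes I: "lift_inv s" and b: "bval s lift_guard"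
  shows "wp U lift_body (\<lambda>s'. lift_inv s' \<and> state_potential s' < state_potential s) s"
proof -
  define e lev cnt Q qh qt p where defs: "e = arrays s ''e''" "lev = arrays s ''lev''"
    "cnt = arrays s ''cnt''" "Q = arrays s ''queue''" "qh = vars s ''qh''" "qt = vars s ''qt''"
    "p = vars s ''p''"
  have inv: "inv e lev cnt Q qh qt p" using I by (simp add: lift_inv_def defs)
  have st: "vars s ''n'' = n" "vars s ''m'' = m" "vars s ''B'' = B" "vars s ''T'' = T"
    "arrays s ''source'' = src" "arrays s ''target'' = tgt" "arrays s ''weight'' = wt"
    "arrays s ''alice'' = ar" "vars s ''j'' = 0"
    using I by (auto simp: lift_inv_def static_def)
  have lnk: "linked m s" and thr: "\<And>v. 0 \<le> v \<Longrightarrow> v < n \<Longrightarrow> arrays s ''thr'' v = thr v"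
    using I by (auto simp: lift_inv_def)
  have pot: "nat x < state_potential s" if "x < potential e lev Q qh qt p" "0 \<le> x" for x
    using that by (simp add: state_potential_def defs)
  note qs = inv_q(1,2)[OF inv] qt_le[OF inv] inv_p[OF inv] fits' fits(1,2)
  note st' = defs[symmetric] st
  show ?thesis
  proof (cases "p < 1")
    case True
    then have p0: "p = 0" using inv_p[OF inv] by simp
    have "qh < qt" using b True by (simp add: lift_guard_def defs)
    have Qh: "0 \<le> Q qh" "Q qh < n" using inv_Q[OF inv, of qh] \<open>qh < qt\<close> inv_q[OF inv] by auto
    define h where "h = arrays s ''head'' (Q qh)"
    have h: "last_in (Q qh) m h" using lnk Qh by (simp add: linked_def h_def)
    note l = load[OF inv[unfolded p0] \<open>qh < qt\<close> h]
    have "0 \<le> h" "h \<le> m" using h by (auto simp: last_in_def)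
    then show ?thesis
      using l p0 qs Qh \<open>qh < qt\<close> pot[OF l(2)[folded p0] potential_nonneg[OF l(1)]] lnk thr
      by (simp add: lift_body_def st' afits_def h_def[symmetric] lift_inv_def static_def linked_def
          state_potential_def)
  next
    case False
    define i where "i = p - 1"
    have i: "0 \<le> i" "i < m" using False inv_p[OF inv] by (auto simp: i_def)
    define r where "r = arrays s ''next'' i"
    have r: "last_in (tgt (p - 1)) (p - 1) r" using lnk i by (simp add: linked_def r_def i_def)
    have rb: "0 \<le> r" "r \<le> m" using r i by (auto simp: last_in_def i_def)
    note v = src[OF i] tgt[OF i]
    have ev: "0 \<le> e (src i)" "e (src i) \<le> T" "0 \<le> e (tgt i)" "e (tgt i) \<le> T"
      "0 \<le> lev i" "lev i \<le> T"
      using inv_e[OF inv] inv_lev[OF inv i] v by auto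
    have w: "\<bar>(- wt i) div B\<bar> \<le> \<bar>wt i\<bar>" by (rule abs_div_le)
    have test: "bval (s\<lparr>vars := (vars s)(''i'' := i)\<rparr>) raisable_test \<longleftrightarrow> raisable e lev i"
      by (auto simp: raisable_test_def raisable_def st')
    have "\<bar>i\<bar> \<le> U" "\<bar>tgt i\<bar> \<le> U" "\<bar>lev i\<bar> \<le> U" "\<bar>T\<bar> \<le> U" "\<bar>e (tgt i)\<bar> \<le> U" "0 \<le> U" "\<bar>B\<bar> \<le> U"
      "\<bar>wt i\<bar> \<le> U" "\<bar>(- wt i) div B\<bar> \<le> U" "\<bar>e (tgt i) + (- wt i) div B\<bar> \<le> U"
      using i v ev w qs fits(3)[of i] T_nonneg B_pos by linarith+
    then have test_fits: "bfits U (s\<lparr>vars := (vars s)(''i'' := i)\<rparr>) raisable_test"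
      by (simp add: raisable_test_def afits_def st')
    show ?thesis
    proof (cases "raisable e lev i")
      case False
      note l = advance[OF inv _ False[unfolded i_def] r]
      have "0 < p" using i by (simp add: i_def)
      note l = l[OF this]
      show ?thesis
        using test test_fits False l qs i rb \<open>\<not> p < 1\<close> pot[OF l(2) potential_nonneg[OF l(1)]] lnk thr
        by (simp add: lift_body_def st' i_def[symmetric] afits_def r_def[symmetric] lift_inv_def
            static_def linked_def state_potential_def)
    next
      case True
      define u k where "u = src i" and "k = u * T + lev i"
      have "lev i < T" using True by (simp add: raisable_def)
      have cu: "0 \<le> cnt k" "cnt k \<le> m"
        using inv_cnt[OF inv, of u "lev i"] v ev \<open>lev i < T\<close> votes_le
        by (auto simp: u_def k_def votes_def)
      have thru: "arrays s ''thr'' u = thr u" "0 \<le> thr u" "thr u \<le> m"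
        using thr[of u] v thr_below_m[of u] thr_below_bounds[OF m_nonneg, of u] n_pos n_le_m
        by (auto simp: u_def)
      have "u * T \<le> (n - 1) * T" using v T_nonneg by (intro mult_right_mono) (auto simp: u_def)
      then have k: "0 \<le> u * T" "u * T \<le> n * T" "0 \<le> k" "k \<le> n * T"
        using v T_nonneg ev by (auto simp: u_def k_def algebra_simps)
      have u: "0 \<le> u" "u < n" using v by (auto simp: u_def)
      have bounds: "\<bar>i\<bar> \<le> U" "\<bar>p\<bar> \<le> U" "\<bar>u\<bar> \<le> U" "\<bar>T\<bar> \<le> U" "\<bar>u * T\<bar> \<le> U" "\<bar>k\<bar> \<le> U"
        "\<bar>lev i\<bar> \<le> U" "\<bar>lev i + 1\<bar> \<le> U" "\<bar>cnt k\<bar> \<le> U" "\<bar>cnt k + 1\<bar> \<le> U" "\<bar>thr u\<bar> \<le> U"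
        "\<bar>e u\<bar> \<le> U" "\<bar>e u + 1\<bar> \<le> U" "\<bar>qt\<bar> \<le> U" "\<bar>qt + 1\<bar> \<le> U" "1 \<le> U"
        using i ev k u cu thru qs T_nonneg unfolding u_def by linarith+
      note sym = i_def[symmetric] u_def[symmetric] k_def[symmetric]
      show ?thesis
      proof (cases "cnt k + 1 = thr u")
        case True': False
        have ne: "cnt (src i * T + lev i) + 1 \<noteq> thr (src i)" using True' by (simp add: k_def u_def)
        note l = raise[OF inv i True ne, folded u_def, folded k_def]
        note facts = test test_fits True l bounds \<open>\<not> p < 1\<close> thru(1)
          pot[OF l(2) potential_nonneg[OF l(1)]] lnk thr
        show ?thesis
        proof (cases "cnt k + 1 < thr u")
          case lt: True
          then show ?thesis using facts
            by (simp add: lift_body_def raise_prog_def st' sym afits_def lift_inv_def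
              static_def linked_def state_potential_def)
        next
          case False
          then have "thr u < cnt k + 1" using True' by simp
          then show ?thesis using facts
            by (simp add: lift_body_def raise_prog_def st' sym afits_def lift_inv_def
              static_def linked_def state_potential_def)
        qed
      next
        case eq: True
        have ne: "cnt (src i * T + lev i) + 1 = thr (src i)" using eq by (simp add: k_def u_def)
        have Za: "Z (src i) (lev i)" if "0 < ar (src i)"
          "\<And>j. 0 \<le> j \<Longrightarrow> j < m \<Longrightarrow> src j = src i \<Longrightarrow> forced j (lev i)"
          using forced_alice[of "src i" "lev i"] v ev \<open>lev i < T\<close> that by blast
        have Zb: "Z (src i) (lev i)" if "\<not> 0 < ar (src i)" "forced i (lev i)"
          using forced_bob[OF i] ev \<open>lev i < T\<close> that by blast
        have l: "inv (e(u := e u + 1)) (lev(i := lev i + 1)) (cnt(k := cnt k + 1)) (Q(qt := u))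
            qh (qt + 1) p"
          "potential (e(u := e u + 1)) (lev(i := lev i + 1)) (Q(qt := u)) qh (qt + 1) p <
            potential e lev Q qh qt p"
          unfolding k_def u_def by - (rule lift[OF inv i True ne]; use Za Zb in blast)+
        show ?thesis
          using test test_fits True l bounds eq \<open>\<not> p < 1\<close> thru(1)
            pot[OF l(2) potential_nonneg[OF l(1)]] lnk thr
          by (simp add: lift_body_def raise_prog_def st' sym afits_def lift_inv_def
            static_def linked_def state_potential_def)
      qed
    qed
  qed
qed

lemma lift_loop:
  assumes "lift_inv s"
  shows "\<exists>t s'. exec U (Loop lift_guard lift_body) s t s' \<and>
    t \<le> (state_potential s + 1) * (1 + bcost lift_guard + cost lift_body) \<and>
    lift_inv s' \<and> \<not> bval s' lift_guard"
proof (rule loop_sound[where \<mu> = state_potential])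
  fix s assume I: "lift_inv s"
  then have "inv (arrays s ''e'') (arrays s ''lev'') (arrays s ''cnt'') (arrays s ''queue'')
       (vars s ''qh'') (vars s ''qt'') (vars s ''p'')" by (simp add: lift_inv_def)
  from inv_q(1,2)[OF this] inv_p[OF this] qt_le[OF this] show "bfits U s lift_guard"
    using fits' by (simp add: lift_guard_def afits_def)
qed (use assms lift_step in auto)

definition output_inv :: "(int \<Rightarrow> int) \<Rightarrow> state \<Rightarrow> bool" where
  "output_inv e s \<longleftrightarrow> static s \<and> arrays s ''e'' = e \<and> 0 \<le> vars s ''j'' \<and> vars s ''j'' \<le> n \<and>
     (\<forall>v. 0 \<le> v \<and> v < vars s ''j'' \<longrightarrow> arrays s ''energy'' v = (if e v < T then B * e v else - 1))"

lemma output_loop: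
  assumes "output_inv e s" and e: "\<And>v. 0 \<le> v \<Longrightarrow> v < n \<Longrightarrow> 0 \<le> e v \<and> e v \<le> T"
  shows "\<exists>t s'. exec U (Loop output_guard output_body) s t s' \<and>
    t \<le> (nat (n - vars s ''j'') + 1) * (1 + bcost output_guard + cost output_body) \<and>
    output_inv e s' \<and> \<not> bval s' output_guard"
proof (rule loop_sound[where \<mu> = "\<lambda>s. nat (n - vars s ''j'')"])
  show "bfits U s output_guard" if "output_inv e s" for s
    using that fits' by (auto simp: output_guard_def afits_def output_inv_def static_def)
next
  fix s assume I: "output_inv e s" and b: "bval s output_guard"
  define j where "j = vars s ''j''"
  have j: "0 \<le> j" "j < n" using I b by (auto simp: output_inv_def output_guard_def static_def j_def)
  have "B * e j \<le> B * T" "0 \<le> B * e j" using e[OF j] B_pos by (auto intro: mult_left_mono)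
  then have "\<bar>j\<bar> \<le> U" "\<bar>j + 1\<bar> \<le> U" "\<bar>e j\<bar> \<le> U" "\<bar>T\<bar> \<le> U" "\<bar>B\<bar> \<le> U" "\<bar>B * e j\<bar> \<le> U" "1 \<le> U"
    using e[OF j] j fits(4) fits' B_pos T_nonneg by linarith+
  moreover have "vars s ''n'' = n" "vars s ''m'' = m" "vars s ''B'' = B" "vars s ''T'' = T"
    "arrays s ''source'' = src" "arrays s ''target'' = tgt" "arrays s ''weight'' = wt"
    "arrays s ''alice'' = ar" "arrays s ''e'' = e"
    and "\<And>v. 0 \<le> v \<Longrightarrow> v < j \<Longrightarrow> arrays s ''energy'' v = (if e v < T then B * e v else - 1)"
    using I by (auto simp: output_inv_def static_def j_def)
  ultimately show "wp U output_body (\<lambda>s'. output_inv e s' \<and> nat (n - vars s' ''j'') < nat (n - vars s ''j'')) s"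
    using j by (simp add: output_body_def afits_def output_inv_def static_def j_def[symmetric])
qed (rule assms)

definition initial :: "state \<Rightarrow> bool" where
  "initial s \<longleftrightarrow> vars s ''n'' = n \<and> vars s ''m'' = m \<and> vars s ''M'' = M \<and> vars s ''c'' = c \<and>
     vars s ''i'' = 0 \<and> vars s ''qt'' = 0 \<and> fresh s \<and>
     arrays s ''source'' = src \<and> arrays s ''target'' = tgt \<and> arrays s ''weight'' = wt \<and>
     arrays s ''alice'' = ar \<and> arrays s ''head'' = (\<lambda>_. 0) \<and> arrays s ''thr'' = (\<lambda>_. 0)"

lemma setup_run:
  assumes "initial s"
  shows "\<exists>t s'. exec U setup_prog s t s' \<and> t \<le> cost setup_prog \<and> link_inv s' \<and> vars s' ''i'' = 0"
proof (rule wp_sound)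
  have "\<bar>M div B\<bar> \<le> \<bar>M\<bar>" using abs_div_le[of "- M"] by simp
  then have M: "\<bar>M div B\<bar> \<le> U" "\<bar>M div B + 1\<bar> \<le> U" "\<bar>M\<bar> \<le> U" using fits(5) by auto
  have zero: "thr_below 0 v = 0" "last_in v 0 0" for v by (auto simp: thr_below_def last_in_def)
  show "wp U setup_prog (\<lambda>s'. link_inv s' \<and> vars s' ''i'' = 0) s"
    using assms M fits(6) fits'(1,4,5) B_pos n_pos m_nonneg zero T_def B_def[symmetric]
    unfolding setup_prog_def wp.simps afits_def initial_def link_inv_def static_def fresh_def linked_def
    by (cases "M div B + 1 < 0") (auto simp: afits_def)
qed

lemma prog_run:
  assumes "initial s"
  shows "\<exists>t s' e. exec U energy_prog s t s' \<and> int t \<le> int prog_cost * (m * (T + 1)) \<and>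
    (\<forall>v. 0 \<le> v \<and> v < n \<longrightarrow> 0 \<le> e v \<and> e v \<le> T \<and>
      arrays s' ''energy'' v = (if e v < T then B * e v else - 1)) \<and>
    (\<forall>v k. 0 \<le> v \<and> v < n \<and> 0 \<le> k \<and> k < e v \<longrightarrow> Z v k) \<and>
    (\<forall>v. 0 \<le> v \<and> v < n \<and> 0 < ar v \<and> e v < T \<longrightarrow>
      (\<exists>i. 0 \<le> i \<and> i < m \<and> src i = v \<and> e (tgt i) < T \<and> e (tgt i) \<le> e v - (- wt i) div B)) \<and>
    (\<forall>i. 0 \<le> i \<and> i < m \<and> \<not> 0 < ar (src i) \<and> e (src i) < T \<longrightarrow>
      e (tgt i) < T \<and> e (tgt i) \<le> e (src i) - (- wt i) div B)"
proof -
  obtain t0 s0 where 0: "exec U setup_prog s t0 s0" "t0 \<le> cost setup_prog" "link_inv s0"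
    "vars s0 ''i'' = 0"
    using setup_run[OF assms] by blast
  obtain t1 s1 where 1: "exec U (Loop link_guard link_body) s0 t1 s1"
    "t1 \<le> (nat m + 1) * (1 + bcost link_guard + cost link_body)" "link_inv s1"
    "\<not> bval s1 link_guard"
    using link_loop[OF 0(3)] 0(4) by auto
  have "vars s1 ''i'' = m" using 1(3,4) by (auto simp: link_inv_def link_guard_def static_def)
  then have q1: "queue_inv s1" "vars s1 ''qt'' = 0"
    using 1(3) thr_below_m n_nonneg by (auto simp: link_inv_def queue_inv_def)
  obtain t2 s2 where 2: "exec U (Loop queue_guard queue_body) s1 t2 s2"
    "t2 \<le> (nat n + 1) * (1 + bcost queue_guard + cost queue_body)" "queue_inv s2"
    "\<not> bval s2 queue_guard"
    using queue_loop[OF q1(1)] q1(2) by auto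
  have "vars s2 ''qt'' = n" using 2(3,4) by (auto simp: queue_inv_def queue_guard_def static_def)
  then have l2: "lift_inv s2" and p2: "state_potential s2 = nat (m * T + (T + 1) * (n + m))"
    using 2(3) inv_init[of "arrays s2 ''queue''"] potential_init[of "arrays s2 ''queue''"]
    by (auto simp: queue_inv_def lift_inv_def fresh_def state_potential_def)
  obtain t3 s3 where 3: "exec U (Loop lift_guard lift_body) s2 t3 s3"
    "t3 \<le> (state_potential s2 + 1) * (1 + bcost lift_guard + cost lift_body)" "lift_inv s3"
    "\<not> bval s3 lift_guard"
    using lift_loop[OF l2] by blast
  define e where "e = arrays s3 ''e''"
  have inv: "inv e (arrays s3 ''lev'') (arrays s3 ''cnt'') (arrays s3 ''queue'')
       (vars s3 ''qh'') (vars s3 ''qt'') (vars s3 ''p'')"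
    using 3(3) by (simp add: lift_inv_def e_def)
  have halt: "vars s3 ''p'' = 0" "\<not> vars s3 ''qh'' < vars s3 ''qt''"
    using 3(4) inv_p[OF inv] by (auto simp: lift_guard_def)
  have o3: "output_inv e s3" "vars s3 ''j'' = 0"
    using 3(3) n_nonneg by (auto simp: lift_inv_def output_inv_def e_def)
  obtain t4 s4 where 4: "exec U (Loop output_guard output_body) s3 t4 s4"
    "t4 \<le> (nat n + 1) * (1 + bcost output_guard + cost output_body)" "output_inv e s4"
    "\<not> bval s4 output_guard"
    using output_loop[OF o3(1) inv_e[OF inv]] o3(2) by auto
  have "vars s4 ''j'' = n" using 4(3,4) by (auto simp: output_inv_def output_guard_def static_def)
  then have energy: "arrays s4 ''energy'' v = (if e v < T then B * e v else - 1)"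
    if "0 \<le> v" "v < n" for v
    using 4(3) that by (simp add: output_inv_def)
  define X where "X = nat (m * (T + 1))"
  have "1 * 1 \<le> m * (T + 1)" using n_pos n_le_m T_nonneg by (intro mult_mono) auto
  then have X: "int X = m * (T + 1)" "1 \<le> X" by (auto simp: X_def)
  have "m * 1 \<le> m * (T + 1)" using n_pos n_le_m T_nonneg by (intro mult_left_mono) auto
  then have "m \<le> int X" using X by simp
  then have mn: "nat m + 1 \<le> 2 * X" "nat n + 1 \<le> 2 * X" using n_le_m X(2) by linarith+
  have "m * T + (T + 1) * (n + m) \<le> m * T + (T + 1) * (m + m)"
    using n_le_m T_nonneg by (intro add_left_mono mult_left_mono) auto
  then have "m * T + (T + 1) * (n + m) + 1 \<le> 4 * (m * (T + 1))"
    using n_pos n_le_m T_nonneg \<open>1 * 1 \<le> m * (T + 1)\<close> by (simp add: algebra_simps)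
  moreover have "0 \<le> m * T + (T + 1) * (n + m)" using n_nonneg m_nonneg T_nonneg by simp
  ultimately have "int (state_potential s2 + 1) \<le> int (4 * X)" using p2 X by simp
  then have p4: "state_potential s2 + 1 \<le> 4 * X" by linarith
  define t where "t = 1 + t0 + (1 + t1 + (1 + t2 + (1 + t3 + t4)))"
  have ex: "exec U energy_prog s t s4"
    unfolding energy_prog_def t_def by (rule exec.Seq[OF 0(1) exec.Seq[OF 1(1) exec.Seq[OF 2(1) exec.Seq[OF 3(1) 4(1)]]]])
  have "t1 \<le> 2 * X * (1 + bcost link_guard + cost link_body)"
    "t2 \<le> 2 * X * (1 + bcost queue_guard + cost queue_body)"
    "t3 \<le> 4 * X * (1 + bcost lift_guard + cost lift_body)"
    "t4 \<le> 2 * X * (1 + bcost output_guard + cost output_body)"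
    using 1(2) 2(2) 3(2) 4(2) mn p4 mult_le_mono1 le_trans by blast+
  moreover have "4 + t0 \<le> X * (4 + cost setup_prog)"
    using X(2) 0(2) mult_le_mono[of 1 X "4 + t0" "4 + cost setup_prog"] by simp
  ultimately have "t \<le> prog_cost * X"
    unfolding t_def prog_cost_def by (simp add: algebra_simps)
  then have "int t \<le> int prog_cost * (m * (T + 1))"
    unfolding X(1)[symmetric] by (simp flip: of_nat_mult)
  moreover note stable_alice[OF inv[unfolded halt(1)] halt(2)]
  moreover have "e (tgt i) < T \<and> e (tgt i) \<le> e (src i) - (- wt i) div B"
    if "0 \<le> i" "i < m" "\<not> 0 < ar (src i)" "e (src i) < T" for i
    using stable_bob[OF inv[unfolded halt(1)] halt(2) _ _ that(3,4,1,2) refl] src[OF that(1,2)] by blast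
  ultimately show ?thesis
    using ex energy inv_e[OF inv] inv_Z[OF inv] src
    by (intro exI[of _ t] exI[of _ s4] exI[of _ e]) auto
qed

end

section \<open>Correctness and running time\<close>

lemma input_magnitude_bounds:
  fixes M c :: int
  assumes "finite (parcs (graph \<Gamma>))" "parcs (graph \<Gamma>) \<noteq> {}"
  defines "N \<equiv> input_magnitude \<Gamma> M c"
  shows "int (card (pverts (graph \<Gamma>))) + int (card (parcs (graph \<Gamma>))) + \<bar>M\<bar> + \<bar>c\<bar> \<le> N"
    and "a \<in> parcs (graph \<Gamma>) \<Longrightarrow>
      int (card (pverts (graph \<Gamma>))) + int (card (parcs (graph \<Gamma>))) + \<bar>weight \<Gamma> a\<bar> + \<bar>M\<bar> + \<bar>c\<bar> \<le> N"
proof -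
  have *: "\<bar>weight \<Gamma> a\<bar> \<le> Max ((\<lambda>a. \<bar>weight \<Gamma> a\<bar>) ` parcs (graph \<Gamma>))"
    if "a \<in> parcs (graph \<Gamma>)" for a
    using assms(1) that by (intro Max_ge) auto
  obtain b where "b \<in> parcs (graph \<Gamma>)" using assms(2) by blast
  from *[OF this] show
    "int (card (pverts (graph \<Gamma>))) + int (card (parcs (graph \<Gamma>))) + \<bar>M\<bar> + \<bar>c\<bar> \<le> N"
    unfolding N_def input_magnitude_def by linarith
  show "int (card (pverts (graph \<Gamma>))) + int (card (parcs (graph \<Gamma>))) + \<bar>weight \<Gamma> a\<bar> + \<bar>M\<bar> + \<bar>c\<bar> \<le> N"
    if "a \<in> parcs (graph \<Gamma>)"
    using *[OF that] unfolding N_def input_magnitude_def by linarith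
qed

lemma energy_prog_correct:
  fixes \<Gamma> :: "nat game"
  assumes "weighted_game \<Gamma>" and V: "pverts (graph \<Gamma>) = {..<n}"
    and es: "set es = parcs (graph \<Gamma>)" "distinct es" "length es = m"
    and M: "\<And>v x. v < n \<Longrightarrow> min_energy \<Gamma> v = enat x \<Longrightarrow> int x \<le> M"
    and c: "int n \<le> c" "ereal (real_of_int c) \<le> ereal (real n) * penalty \<Gamma>"
  shows "\<exists>t s. exec (input_magnitude \<Gamma> M c ^ 2) energy_prog (input_state \<Gamma> es M c) t s \<and>
    real t \<le> real (4 * prog_cost) * (real m * max 1 (real n * real_of_int M / real_of_int c)) \<and>
    (\<forall>v < n. output_energy s v \<le> min_energy \<Gamma> v \<and>
             min_energy \<Gamma> v \<le> output_energy s v + enat (nat c))"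
proof -
  interpret game \<Gamma> by unfold_locales (rule assms(1))
  define U where "U = input_magnitude \<Gamma> M c ^ 2"
  define B where "B = c div int n"
  define T where "T = max 0 (M div B + 1)"
  have n: "0 < n" using V_nonempty V by (auto simp: lessThan_empty_iff)
  have B: "1 \<le> B" using c(1) n zdiv_mono1[of "int n" c "int n"] by (simp add: B_def)
  have Bn: "B * int n \<le> c" "c < B * int n + int n"
    using n pos_mod_sign[of "int n" c] pos_mod_bound[of "int n" c] mult_div_mod_eq[of "int n" c]
    unfolding B_def mult.commute[of _ "int n"] by linarith+
  have T: "0 \<le> T" by (simp add: T_def)

  define \<Delta> where "\<Delta> = round_up B \<Gamma>"
  interpret R: game \<Delta> unfolding \<Delta>_def by (rule game_round_up)
  have \<Delta>: "graph \<Delta> = graph \<Gamma>" "alice \<Delta> = alice \<Gamma>" "bob \<Delta> = bob \<Gamma>"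
    by (simp_all add: \<Delta>_def)
  have lower: "min_energy \<Delta> v \<le> enat (nat (int y div B))" if "v < n" "min_energy \<Gamma> v \<le> enat y" for v y
    unfolding \<Delta>_def by (rule min_energy_round_up_le) (use B V that in auto)
  have "ereal (real_of_int B - 1) < penalty \<Gamma>"
  proof (rule ccontr)
    assume "\<not> ereal (real_of_int B - 1) < penalty \<Gamma>"
    then have "ereal (real n) * penalty \<Gamma> \<le> ereal (real n) * ereal (real_of_int B - 1)"
      by (intro ereal_mult_left_mono) auto
    then have "ereal (real_of_int c) \<le> ereal (real n * (real_of_int B - 1))"
      using c(2) order_trans by fastforce
    then have "real_of_int c \<le> real n * (real_of_int B - 1)" by simp
    then have "real_of_int c \<le> real_of_int (int n * (B - 1))" by simp
    then have "c \<le> int n * (B - 1)" by linarith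
    then show False using Bn(1) n by (simp add: algebra_simps)
  qed
  then have upper: "min_energy \<Gamma> v \<le> enat (nat (B * int x + B * int n))"
    if "v < n" "min_energy \<Delta> v \<le> enat x" for v x
  proof -
    have "v \<in> V" using that V by simp
    then obtain D where "has_penalty \<Gamma> v D" "real_of_int B - 1 < D"
      using penalty_witness \<open>ereal (real_of_int B - 1) < penalty \<Gamma>\<close> by blast
    then have "min_energy \<Gamma> v \<le> enat (nat (B * int x + B * int (card V)))"
      using B \<open>v \<in> V\<close> that(2) unfolding \<Delta>_def by (intro min_energy_le_round_up) auto
    then show ?thesis by (simp add: V)
  qed
  have below_T: "int x < T" if v: "v < n" "min_energy \<Delta> v = enat x" for v x
  proof -
    obtain z where z: "min_energy \<Gamma> v = enat z"
      using upper[OF v(1), of x] v(2) by (cases "min_energy \<Gamma> v") auto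
    have "0 \<le> int z div B" using B by (simp add: pos_imp_zdiv_nonneg_iff)
    then have "int x \<le> int z div B" using lower[OF that(1), of z] that(2) z by simp
    also have "\<dots> \<le> M div B" using M[OF that(1) z] B by (intro zdiv_mono1) auto
    finally show ?thesis by (simp add: T_def)
  qed

  define src where "src = array_of (map (\<lambda>a. int (fst a)) es)"
  define tgt where "tgt = array_of (map (\<lambda>a. int (snd a)) es)"
  define wt where "wt = array_of (map (weight \<Gamma>) es)"
  define ar where "ar = array_of (map (\<lambda>v. if v \<in> alice \<Gamma> then 1 else 0) [0..<n])"
  define Z where "Z = (\<lambda>v k. enat (nat k) < min_energy \<Delta> (nat v))"
  have arc: "\<exists>u v. (u, v) \<in> E \<and> u < n \<and> v < n \<and> src i = int u \<and> tgt i = int v \<and>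
      (- wt i) div B = - weight \<Delta> (u, v)" if "0 \<le> i" "i < int m" for i
  proof -
    have "es ! nat i \<in> E" using that es by (simp flip: es(1))
    moreover obtain u v where "es ! nat i = (u, v)" by (cases "es ! nat i")
    ultimately show ?thesis
      using in_arcsD1 in_arcsD2 V that es(3)
      by (intro exI[of _ u] exI[of _ v])
        (auto simp: src_def tgt_def wt_def array_of_def \<Delta>_def nat_less_iff)
  qed
  have arc_index: "\<exists>i. 0 \<le> i \<and> i < int m \<and> src i = int u \<and> tgt i = int v \<and>
      (- wt i) div B = - weight \<Delta> (u, v)" if uv: "(u, v) \<in> E" for u v
  proof -
    obtain j where "j < length es" "es ! j = (u, v)"
      using uv unfolding es(1)[symmetric] in_set_conv_nth by blast
    then show ?thesis using es(3)
      by (intro exI[of _ "int j"]) (auto simp: src_def tgt_def wt_def array_of_def \<Delta>_def)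
  qed
  have ar: "0 < ar (int v) \<longleftrightarrow> v \<in> alice \<Gamma>" if "v < n" for v
    using that by (simp add: ar_def array_of_def)
  have m: "int n \<le> int m"
  proof -
    have "V \<subseteq> fst ` E" using out_arc by force
    then have "card V \<le> card (fst ` E)" by (intro card_mono) (use pair_finite_arcs in auto)
    also have "\<dots> \<le> card E" by (rule card_image_le) (rule pair_finite_arcs)
    also have "card E = m" using distinct_card[OF es(2)] es by simp
    finally show ?thesis by (simp add: V)
  qed
  have E_card: "card E = m" "E \<noteq> {}"
    using distinct_card[OF es(2)] es m n by auto

  interpret lifting "int n" "int m" T src tgt "\<lambda>i. (- wt i) div B" "\<lambda>v. 0 < ar v" Z
  proof
    show "\<exists>i. 0 \<le> i \<and> i < int m \<and> src i = v" if "0 \<le> v" "v < int n" for v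
    proof -
      have "nat v \<in> V" using that V by auto
      then obtain u where "(nat v, u) \<in> E" using out_arc by blast
      then show ?thesis using arc_index[of "nat v" u] that by auto
    qed
  qed (use T arc in force)+
  have not_forced: "\<not> forced i k"
    if u: "tgt i = int u" "(- wt i) div B = - x" "u < n" "0 \<le> k + x"
      "min_energy \<Delta> u \<le> enat (nat (k + x))" "0 < T" for i k u x
  proof -
    obtain y where y: "min_energy \<Delta> u = enat y" using u(5) by (cases "min_energy \<Delta> u") auto
    then have "int y < T" using below_T that(3) by blast
    then have "\<not> Z (tgt i) (T - 1)" using y that(1,6) by (simp add: Z_def)
    moreover have "\<not> Z (tgt i) (k - (- wt i) div B)" using that(1,2,5) by (simp add: Z_def not_less)
    ultimately show ?thesis using that(2,4) by (simp add: forced_def)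
  qed
  define N where "N = input_magnitude \<Gamma> M c"
  have N: "int n + int m + \<bar>M\<bar> + c \<le> N"
    and Nw: "a \<in> E \<Longrightarrow> int n + int m + \<bar>weight \<Gamma> a\<bar> + \<bar>M\<bar> + c \<le> N" for a
    using input_magnitude_bounds[OF pair_finite_arcs E_card(2), where M = M and c = c] E_card(1) V c(1) n
    unfolding N_def by auto
  have "\<bar>M div B\<bar> \<le> \<bar>M\<bar>"
  proof (cases "0 \<le> M")
    case True
    then have "0 \<le> M div B" using B by (simp add: pos_imp_zdiv_nonneg_iff)
    moreover have "M div B \<le> M" using True B zdiv_mono2[of M 1 B] by simp
    ultimately show ?thesis by simp
  next
    case False
    then show ?thesis using B zdiv_mono2_neg[of M 1 B] div_nonpos_pos_le0[of M B] by simp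
  qed
  then have TM: "T \<le> \<bar>M\<bar> + 1" by (auto simp: T_def)
  have "N \<ge> 1" using N n c(1) by simp
  then have NU: "N \<le> U" using mult_left_mono[of 1 N N] by (simp add: U_def N_def power2_eq_square)
  have "int n * (\<bar>M\<bar> + 3) \<le> N * N"
    using N n m c(1) by (intro mult_mono) auto
  then have "int n * (\<bar>M\<bar> + 3) \<le> U" by (simp add: U_def N_def power2_eq_square)
  moreover have "int n + int n * T + 1 \<le> int n * (\<bar>M\<bar> + 3)"
  proof -
    have "int n * T \<le> int n * (\<bar>M\<bar> + 1)" using TM by (intro mult_left_mono) auto
    then show ?thesis using n by (simp add: algebra_simps)
  qed
  ultimately have U1: "int n + int n * T + 1 \<le> U" by linarith
  have wt: "\<bar>wt i\<bar> + T \<le> U" for i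
  proof (cases "0 \<le> i \<and> i < int m")
    case True
    then have "es ! nat i \<in> E" "wt i = weight \<Gamma> (es ! nat i)"
      using es by (auto simp: wt_def array_of_def simp flip: es(1))
    then show ?thesis using Nw[of "es ! nat i"] NU TM n c(1) by linarith
  next
    case False
    then have "wt i = 0" using es(3) by (auto simp: wt_def array_of_def)
    then show ?thesis using N NU TM n c(1) by simp
  qed
  have "B * 1 \<le> B * int n" using B n by (intro mult_left_mono) auto
  then have Bc: "B \<le> c" using Bn(1) by simp
  have BT: "B * T \<le> U"
  proof (cases "M div B + 1 \<le> 0")
    case True
    then show ?thesis using NU \<open>1 \<le> N\<close> by (simp add: T_def)
  next
    case False
    then have "B * T = B * (M div B) + B" by (simp add: T_def algebra_simps)
    also have "\<dots> \<le> M + B"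
      using B pos_mod_sign[of B M] mult_div_mod_eq[of B M] by linarith
    finally show ?thesis using Bc N NU by linarith
  qed
  interpret energy_run "int n" "int m" T src tgt wt B ar Z M c U
  proof
    show "ar v \<in> {0..1}" for v by (auto simp: ar_def array_of_def)
    show "Z v k" if "0 \<le> v" "v < int n" "0 < ar v" "0 \<le> k" "k < T"
      and forced: "\<And>i. 0 \<le> i \<Longrightarrow> i < int m \<Longrightarrow> src i = v \<Longrightarrow> forced i k" for v k
    proof (rule ccontr)
      assume "\<not> Z v k"
      then have "min_energy \<Delta> (nat v) \<le> enat (nat k)" by (simp add: Z_def)
      moreover have "nat v \<in> alice \<Delta>" using ar[of "nat v"] that by (simp add: \<Delta> nat_less_iff)
      ultimately obtain u where u: "(nat v, u) \<in> E" "0 \<le> int (nat k) + weight \<Delta> (nat v, u)"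
        "min_energy \<Delta> u \<le> enat (nat (int (nat k) + weight \<Delta> (nat v, u)))"
        using R.min_energy_step_alice unfolding \<Delta> by blast
      obtain i where i: "0 \<le> i" "i < int m" "src i = int (nat v)" "tgt i = int u"
        "(- wt i) div B = - weight \<Delta> (nat v, u)"
        using arc_index[OF u(1)] by blast
      have "u < n" using u(1) in_arcsD2 V by auto
      then have "\<not> forced i k" using not_forced[OF i(4,5)] u that by simp
      then show False using forced[of i] i that by simp
    qed
    show "Z (src i) k" if i: "0 \<le> i" "i < int m" "\<not> 0 < ar (src i)" "0 \<le> k" "k < T" "forced i k" for i k
    proof (rule ccontr)
      assume Zn: "\<not> Z (src i) k"
      obtain u v where a: "(u, v) \<in> E" "u < n" "v < n" "src i = int u" "tgt i = int v"
        "(- wt i) div B = - weight \<Delta> (u, v)" using arc[OF i(1,2)] by blast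
      have "min_energy \<Delta> u \<le> enat (nat k)" using Zn a by (simp add: Z_def)
      moreover have "u \<in> bob \<Delta>" using ar[of u] that a players V by (auto simp: \<Delta>)
      ultimately have "0 \<le> int (nat k) + weight \<Delta> (u, v)"
        "min_energy \<Delta> v \<le> enat (nat (int (nat k) + weight \<Delta> (u, v)))"
        using R.min_energy_step_bob a(1) unfolding \<Delta> by blast+
      then have "\<not> forced i k" using not_forced[OF a(5,6,3)] that by simp
      then show False using that by blast
    qed
    show "int n + int n * T + 1 \<le> U" "\<bar>wt i\<bar> + T \<le> U" "B * T \<le> U" for i by (fact U1 wt BT)+
  qed (use n m B N NU c(1) in \<open>auto simp: B_def T_def\<close>)

  have "initial (input_state \<Gamma> es M c)"
    unfolding initial_def fresh_def input_state_def
    by (simp add: V es(3) src_def tgt_def wt_def ar_def fun_eq_iff)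
  from prog_run[OF this] obtain t s e where
    run: "exec U energy_prog (input_state \<Gamma> es M c) t s"
      "int t \<le> int prog_cost * (int m * (T + 1))"
    and e_out: "\<forall>v. 0 \<le> v \<and> v < int n \<longrightarrow> 0 \<le> e v \<and> e v \<le> T \<and>
      arrays s ''energy'' v = (if e v < T then B * e v else - 1)"
    and Z: "\<forall>v k. 0 \<le> v \<and> v < int n \<and> 0 \<le> k \<and> k < e v \<longrightarrow> Z v k"
    and alice: "\<forall>v. 0 \<le> v \<and> v < int n \<and> 0 < ar v \<and> e v < T \<longrightarrow>
      (\<exists>i. 0 \<le> i \<and> i < int m \<and> src i = v \<and> e (tgt i) < T \<and> e (tgt i) \<le> e v - (- wt i) div B)"
    and bob: "\<forall>i. 0 \<le> i \<and> i < int m \<and> \<not> 0 < ar (src i) \<and> e (src i) < T \<longrightarrow>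
      e (tgt i) < T \<and> e (tgt i) \<le> e (src i) - (- wt i) div B"
    by (elim exE conjE) (rule that)
  have e: "0 \<le> e v \<and> e v \<le> T" if "0 \<le> v" "v < int n" for v
    using e_out that by blast
  have out: "arrays s ''energy'' v = (if e v < T then B * e v else - 1)" if "0 \<le> v" "v < int n" for v
    using e_out that by blast

  have finite_le: "min_energy \<Delta> v \<le> enat (nat (e (int v)))" if "v < n" "e (int v) < T" for v
  proof (rule R.min_energy_le_progress_measure[where e = "\<lambda>v. e (int v)" and T = T])
    show "0 \<le> e (int v)" if "v \<in> pverts (graph \<Delta>)" for v using e that by (simp add: \<Delta> V)
    show "\<exists>u. (v, u) \<in> parcs (graph \<Delta>) \<and> e (int u) < T \<and> e (int u) \<le> e (int v) + weight \<Delta> (v, u)"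
      if v: "v \<in> alice \<Delta>" "e (int v) < T" for v
    proof -
      have "v < n" using v players V by (auto simp: \<Delta>)
      then obtain i where i: "0 \<le> i" "i < int m" "src i = int v" "e (tgt i) < T"
        "e (tgt i) \<le> e (int v) - (- wt i) div B"
        using alice[rule_format, of "int v"] ar v by (auto simp: \<Delta>)
      then show ?thesis using arc[OF i(1,2)] by (auto simp: \<Delta>)
    qed
    show "e (int u) < T \<and> e (int u) \<le> e (int v) + weight \<Delta> (v, u)"
      if vu: "v \<in> bob \<Delta>" "e (int v) < T" "(v, u) \<in> parcs (graph \<Delta>)" for v u
    proof -
      have "v < n" "v \<notin> alice \<Gamma>" using that players V by (auto simp: \<Delta>)
      moreover obtain i where "0 \<le> i" "i < int m" "src i = int v" "tgt i = int u"
        "(- wt i) div B = - weight \<Delta> (v, u)" using arc_index vu(3) by (auto simp: \<Delta>)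
      ultimately show ?thesis using bob[rule_format, of i] ar[of v] that(2) by simp
    qed
  qed (use that in \<open>simp_all add: \<Delta> V\<close>)
  have finite_eq: "min_energy \<Delta> v = enat (nat (e (int v)))" if "v < n" "e (int v) < T" for v
  proof (rule antisym[OF finite_le[OF that]])
    show "enat (nat (e (int v))) \<le> min_energy \<Delta> v"
    proof (cases "e (int v) = 0")
      case False
      then have "Z (int v) (e (int v) - 1)" using Z[rule_format, of "int v" "e (int v) - 1"] e[of "int v"] that by simp
      then have "eSuc (enat (nat (e (int v) - 1))) \<le> min_energy \<Delta> v"
        unfolding Z_def by (simp add: ileI1)
      moreover have "Suc (nat (e (int v) - 1)) = nat (e (int v))" using False e[of "int v"] that by auto
      ultimately show ?thesis by (simp add: eSuc_enat)
    qed (simp add: zero_enat_def[symmetric])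
  qed
  have infinite: "min_energy \<Delta> v = \<infinity>" if "v < n" "\<not> e (int v) < T" for v
  proof (cases "min_energy \<Delta> v")
    case (enat x)
    then have "int x < T" using below_T that(1) by blast
    then have "Z (int v) (int x)" using Z[rule_format, of "int v" "int x"] that by simp
    then show ?thesis using enat by (simp add: Z_def)
  qed
  have approx: "output_energy s v \<le> min_energy \<Gamma> v \<and>
      min_energy \<Gamma> v \<le> output_energy s v + enat (nat c)" if "v < n" for v
  proof (cases "e (int v) < T")
    case True
    have ev: "0 \<le> e (int v)" using e[of "int v"] that by simp
    then have o: "output_energy s v = enat (nat (B * e (int v)))"
      using out[of "int v"] that True B by (simp add: output_energy_def mult_less_0_iff)
    have "output_energy s v \<le> min_energy \<Gamma> v"
    proof (cases "min_energy \<Gamma> v")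
      case (enat y)
      then have "nat (e (int v)) \<le> nat (int y div B)"
        using lower[OF that, of y] finite_eq[OF that True] by simp
      then have "e (int v) \<le> int y div B"
        using B by (simp add: pos_imp_zdiv_nonneg_iff nat_le_eq_zle)
      then have "B * e (int v) \<le> B * (int y div B)" using B by (intro mult_left_mono) auto
      also have "\<dots> \<le> int y"
        using B pos_mod_sign[of B "int y"] mult_div_mod_eq[of B "int y"] by linarith
      finally show ?thesis using o enat by simp
    qed simp
    moreover have "min_energy \<Gamma> v \<le> output_energy s v + enat (nat c)"
    proof -
      have "min_energy \<Gamma> v \<le> enat (nat (B * e (int v) + B * int n))"
        using upper[OF that, of "nat (e (int v))"] finite_eq[OF that True] ev by simp
      also have "\<dots> \<le> enat (nat (B * e (int v)) + nat c)"
        using Bn(1) by simp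
      finally show ?thesis using o by simp
    qed
    ultimately show ?thesis by blast
  next
    case False
    then have "output_energy s v = \<infinity>"
      using out[of "int v"] that by (simp add: output_energy_def)
    moreover have "min_energy \<Gamma> v = \<infinity>"
      using lower[OF that] infinite[OF that False] by (cases "min_energy \<Gamma> v") auto
    ultimately show ?thesis by simp
  qed

  define X where "X = max 1 (real n * real_of_int M / real_of_int c)"
  have "1 \<le> X" "real n * real_of_int M / real_of_int c \<le> X" by (simp_all add: X_def)
  have "real_of_int (T + 1) \<le> 4 * X"
  proof (cases "0 \<le> M")
    case True
    then have "0 \<le> M div B" using B by (simp add: pos_imp_zdiv_nonneg_iff)
    then have "real_of_int (T + 1) = real_of_int (M div B) + 2" by (simp add: T_def)
    also have "real_of_int (M div B) \<le> real_of_int M / real_of_int B"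
      by (rule real_of_int_div4)
    also have "\<dots> \<le> 2 * (real n * real_of_int M / real_of_int c)"
    proof -
      have "int n * 1 \<le> int n * B" using B by (intro mult_left_mono) auto
      then have "c \<le> 2 * int n * B" using Bn(2) by (simp add: algebra_simps)
      then have "real_of_int c \<le> real_of_int (2 * int n * B)" by linarith
      then have "real_of_int M * real_of_int c \<le> real_of_int M * (2 * real n * real_of_int B)"
        using True by (intro mult_left_mono) auto
      then show ?thesis using B c(1) n by (simp add: field_simps)
    qed
    finally show ?thesis using \<open>1 \<le> X\<close> \<open>real n * real_of_int M / real_of_int c \<le> X\<close> by linarith
  next
    case False
    then have "M div B < 0" using B by (simp add: neg_imp_zdiv_neg_iff pos_imp_zdiv_neg_iff)
    then have "T = 0" by (simp add: T_def)
    then show ?thesis by (simp add: X_def)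
  qed
  then have "real prog_cost * (real m * real_of_int (T + 1)) \<le> real prog_cost * (real m * (4 * X))"
    by (intro mult_left_mono) auto
  moreover have "real t \<le> real prog_cost * (real m * real_of_int (T + 1))"
  proof -
    have "real_of_int (int t) \<le> real_of_int (int prog_cost * (int m * (T + 1)))"
      using run(2) by (simp only: of_int_le_iff)
    then show ?thesis by simp
  qed
  ultimately have "real t \<le> real (4 * prog_cost) * (real m * X)" by (simp add: algebra_simps)
  then show ?thesis using run(1) approx unfolding U_def X_def by blast
qed

theorem theorem2:
  shows "\<exists>(prog :: com) (k :: nat) (K :: real).
    \<forall>(\<Gamma> :: nat game) (es :: (nat \<times> nat) list) (n :: nat) (m :: nat) (M :: int) (c :: int).
      weighted_game \<Gamma> \<longrightarrow>
      pverts (graph \<Gamma>) = {..<n} \<longrightarrow>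
      set es = parcs (graph \<Gamma>) \<and> distinct es \<and> length es = m \<longrightarrow>
      1 \<le> penalty \<Gamma> \<longrightarrow>
      (\<forall>v < n. \<forall>x :: nat. min_energy \<Gamma> v = enat x \<longrightarrow> int x \<le> M) \<longrightarrow>
      int n \<le> c \<and> ereal (real_of_int c) \<le> ereal (real n) * penalty \<Gamma> \<longrightarrow>
      (\<exists>(t :: nat) (s :: state).
        exec (input_magnitude \<Gamma> M c ^ k) prog (input_state \<Gamma> es M c) t s \<and>
        real t \<le> K * (real m * max 1 (real n * real_of_int M / real_of_int c)) \<and>
        (\<forall>v < n. output_energy s v \<le> min_energy \<Gamma> v \<and>
                 min_energy \<Gamma> v \<le> output_energy s v + enat (nat c)))"
  by (intro exI[of _ energy_prog] exI[of _ 2] exI[of _ "real (4 * prog_cost)"] allI impI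
      energy_prog_correct) auto

end
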